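(* The Binary Partial Coding Problem can be reduced in polynomial time to the Windows Scheduling Problem with one machine, uniform (unit) job lengths and exact periods. Moreover, the reduction transforms instances with $d$ attributes into scheduling instances whose maximum period is $d^{O(d)}$.
   Context: Partial Coding Problem: given $d$ attributes with value ranges $f_1,\ldots,f_d$ (integers $\ge 2$) and symbols $s_1,\ldots,s_n\subseteq\{1,\ldots,d\}$, an encoding of $s_j$ is a map $c_j:s_j\to\mathbb{N}$ with $c_j(i)\in[0,f_i-1]$; encodings are feasible if for every $j\ne k$ there is $i\in s_j\cap s_k$ with $c_j(i)\ne c_k(i)$; decide whether a feasible encoding exists. The Binary Partial Coding Problem is the special case $f_i=2$ for all $i$. Windows Scheduling with one machine, unit-length jobs and exact periods: given positive integers $p_1,\ldots,p_n$, decide whether there exist integer start times $t_1,\ldots,t_n$ such that, with job $j$ executed exactly in time slots $t_j+kp_j$ ($k\in\mathbb{Z}$), no two distinct jobs occupy the same slot. A reduction maps yes-instances to yes-instances and no-instances to no-instances. *)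

theory Defs
  imports
    Complex_Main
    "HOL-Library.FuncSet"
    "HOL-Library.Landau_Symbols"
    "HOL-Computational_Algebra.Polynomial"
begin

section \<open>Polynomial-time computability by deterministic multi-tape Turing machines\<close>

text \<open>
  A machine has \<open>num_tapes\<close> two-way infinite tapes over the alphabet \<open>{..<num_symbols}\<close>,
  where \<open>0\<close> is the blank, non-halting states \<open>{..<num_states}\<close> with start state \<open>0\<close>, and the
  single halting state \<open>num_states\<close>. The transition function receives the state and the symbols
  under the heads; it returns the next state and, for each tape, the symbol to be written and the
  subsequent displacement of the head. Only its values on the finite domain described by \<open>wf_tm\<close>
  are ever relevant, so a well-formed machine is a finite object.
\<close>

record tm =
  num_tapes :: nat
  num_symbols :: nat
  num_states :: nat
  delta :: "nat \<Rightarrow> nat list \<Rightarrow> nat \<times> (nat \<times> int) list"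

definition wf_tm :: "tm \<Rightarrow> bool" where
  "wf_tm M \<longleftrightarrow>
     num_tapes M \<ge> 1 \<and> num_symbols M \<ge> 1 \<and>
     (\<forall>q rs. q < num_states M \<and> length rs = num_tapes M \<and> set rs \<subseteq> {..<num_symbols M} \<longrightarrow>
        (case delta M q rs of (q', as) \<Rightarrow>
           q' \<le> num_states M \<and> length as = num_tapes M \<and>
           (\<forall>(w, m) \<in> set as. w < num_symbols M \<and> m \<in> {-1, 0, 1})))"

text \<open>A tape is its contents together with the position of its head.\<close>

type_synonym tape = "(int \<Rightarrow> nat) \<times> int"
type_synonym config = "nat \<times> tape list"

definition read_tape :: "tape \<Rightarrow> nat" where
  "read_tape = (\<lambda>(f, h). f h)"

definition act_tape :: "nat \<times> int \<Rightarrow> tape \<Rightarrow> tape" where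
  "act_tape = (\<lambda>(w, m) (f, h). (f(h := w), h + m))"

definition tm_step :: "tm \<Rightarrow> config \<Rightarrow> config" where
  "tm_step M = (\<lambda>(q, ts).
     if q < num_states M
     then (case delta M q (map read_tape ts) of (q', as) \<Rightarrow> (q', map2 act_tape as ts))
     else (q, ts))"

definition input_tape :: "nat list \<Rightarrow> tape" where
  "input_tape xs = (\<lambda>i. if 0 \<le> i \<and> i < int (length xs) then xs ! nat i else 0, 0)"

definition tm_init :: "tm \<Rightarrow> nat list \<Rightarrow> config" where
  "tm_init M xs = (0, input_tape xs # replicate (num_tapes M - 1) (input_tape []))"

text \<open>The output is read from the head of the first tape up to (excluding) the next blank.\<close>

definition output_on :: "tape \<Rightarrow> nat list \<Rightarrow> bool" where
  "output_on = (\<lambda>(f, h) ys.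
     0 \<notin> set ys \<and> (\<forall>i < length ys. f (h + int i) = ys ! i) \<and> f (h + int (length ys)) = 0)"

definition tm_computes_within :: "tm \<Rightarrow> nat list \<Rightarrow> nat list \<Rightarrow> nat \<Rightarrow> bool" where
  "tm_computes_within M xs ys b \<longleftrightarrow>
     set xs \<subseteq> {1..<num_symbols M} \<and>
     (\<exists>t \<le> b. case (tm_step M ^^ t) (tm_init M xs) of (q, ts) \<Rightarrow>
        q = num_states M \<and> output_on (hd ts) ys)"

definition polytime_computable ::
    "'a set \<Rightarrow> ('a \<Rightarrow> nat list) \<Rightarrow> ('b \<Rightarrow> nat list) \<Rightarrow> ('a \<Rightarrow> 'b) \<Rightarrow> bool" where
  "polytime_computable I enc_in enc_out f \<longleftrightarrow>
     (\<exists>M. \<exists>p :: nat poly. wf_tm M \<and>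
        (\<forall>x \<in> I. tm_computes_within M (enc_in x) (enc_out (f x))
                    (poly p (length (enc_in x)))))"

text \<open>
  Many-one reductions from the decision problem with instances \<open>I\<close> and yes-instances \<open>Y\<close> to the
  one with instances \<open>J\<close> and yes-instances \<open>Z\<close>.
\<close>

definition polytime_reduction ::
    "'a set \<Rightarrow> 'a set \<Rightarrow> ('a \<Rightarrow> nat list) \<Rightarrow> 'b set \<Rightarrow> 'b set \<Rightarrow> ('b \<Rightarrow> nat list) \<Rightarrow>
     ('a \<Rightarrow> 'b) \<Rightarrow> bool" where
  "polytime_reduction I Y enc_in J Z enc_out R \<longleftrightarrow>
     R \<in> I \<rightarrow> J \<and> (\<forall>x \<in> I. x \<in> Y \<longleftrightarrow> R x \<in> Z) \<and> polytime_computable I enc_in enc_out R"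


section \<open>Partial coding\<close>

text \<open>
  An instance consists of the number \<open>d\<close> of attributes, the value ranges \<open>f 1, \<dots>, f d\<close> and the
  list of symbols. The list may contain repetitions: equal symbols at different positions have to be
  told apart as well. An encoding is a function on all of \<open>nat\<close> whose values outside of
  the symbol are irrelevant.
\<close>

definition partial_coding_instance :: "nat \<Rightarrow> (nat \<Rightarrow> nat) \<Rightarrow> nat set list \<Rightarrow> bool" where
  "partial_coding_instance d f ss \<longleftrightarrow>
     (\<forall>i \<in> {1..d}. f i \<ge> 2) \<and> (\<forall>s \<in> set ss. s \<subseteq> {1..d})"

definition is_encoding :: "(nat \<Rightarrow> nat) \<Rightarrow> nat set \<Rightarrow> (nat \<Rightarrow> nat) \<Rightarrow> bool" where
  "is_encoding f s c \<longleftrightarrow> (\<forall>i \<in> s. c i \<in> {0..f i - 1})"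

definition feasible_encodings :: "nat set list \<Rightarrow> (nat \<Rightarrow> nat \<Rightarrow> nat) \<Rightarrow> bool" where
  "feasible_encodings ss c \<longleftrightarrow>
     (\<forall>j < length ss. \<forall>k < length ss. j \<noteq> k \<longrightarrow> (\<exists>i \<in> ss ! j \<inter> ss ! k. c j i \<noteq> c k i))"

definition has_feasible_encoding :: "(nat \<Rightarrow> nat) \<Rightarrow> nat set list \<Rightarrow> bool" where
  "has_feasible_encoding f ss \<longleftrightarrow>
     (\<exists>c. (\<forall>j < length ss. is_encoding f (ss ! j) (c j)) \<and> feasible_encodings ss c)"

definition bpc_instances :: "(nat \<times> nat set list) set" where
  "bpc_instances = {(d, ss). partial_coding_instance d (\<lambda>_. 2) ss}"

definition bpc_yes :: "(nat \<times> nat set list) set" where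
  "bpc_yes = {(d, ss) \<in> bpc_instances. has_feasible_encoding (\<lambda>_. 2) ss}"


section \<open>Windows scheduling: one machine, unit-length jobs, exact periods\<close>

definition ws_instances :: "nat list set" where
  "ws_instances = {ps. \<forall>p \<in> set ps. p > 0}"

definition job_slots :: "int \<Rightarrow> nat \<Rightarrow> int set" where
  "job_slots t p = {t + k * int p | k :: int. True}"

definition ws_yes :: "nat list set" where
  "ws_yes = {ps \<in> ws_instances. \<exists>t :: nat \<Rightarrow> int.
     \<forall>j < length ps. \<forall>k < length ps.
       j \<noteq> k \<longrightarrow> job_slots (t j) (ps ! j) \<inter> job_slots (t k) (ps ! k) = {}}"


section \<open>Representation of instances as strings\<close>

text \<open>
  The symbols \<open>1\<close> and \<open>2\<close> represent the bits 0 and 1, and \<open>3\<close> is a terminator. The number of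
  attributes is written in unary, because an instance lists all \<open>d\<close> attributes, and each symbol is
  given by its characteristic vector. Periods are written in binary, least significant bit first.
\<close>

definition enc_bit :: "bool \<Rightarrow> nat" where
  "enc_bit b = (if b then 2 else 1)"

definition enc_bpc :: "nat \<times> nat set list \<Rightarrow> nat list" where
  "enc_bpc = (\<lambda>(d, ss).
     replicate d 2 @ [3] @
     concat (map (\<lambda>s. map (\<lambda>i. enc_bit (i \<in> s)) [1..<Suc d] @ [3]) ss))"

fun enc_nat :: "nat \<Rightarrow> nat list" where
  "enc_nat n = (if n = 0 then [] else enc_bit (odd n) # enc_nat (n div 2))"

declare enc_nat.simps [simp del]

definition enc_ws :: "nat list \<Rightarrow> nat list" where
  "enc_ws ps = concat (map (\<lambda>p. enc_nat p @ [3]) ps)"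

end

(*
  Every attribute k < e gets two coprime moduli a_k and b_k built from primes of size O(e^2).  The
  job of a symbol s has as period twice the product of the a_k with k in s and of the b_k with k not
  in s, so two such jobs can be separated modulo a_k exactly if both symbols contain k.  To cut the
  residues modulo a_k down to two and those modulo b_k down to one, there are (a_k - 2)(b_k - 1)
  blockers of period e * a_k * b_k.  Blockers of different attributes have gcd e, hence occupy
  different classes modulo e; as there are only e classes, all blockers of one attribute lie in the
  same class and are pairwise different modulo a_k * b_k, which makes them block enough residues.
  The additional empty symbol avoids the blocked residues modulo every b_k, and it forces the other
  symbols into the opposite class modulo 2, so that this factor separates nothing else.

  For polynomial time, programs over a fixed number of stacks are compiled to Turing machines: a
  tape whose head is at the top of the stack reads the stack from left to right, as required of
  inputs and outputs.  Bounded loops over such programs suffice to compute with unary numbers and to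
  multiply a binary number by a unary one.
*)

theory Submission
  imports Defs "HOL-Number_Theory.Cong"
begin

section \<open>Stack programs and their compilation to Turing machines\<close>

text \<open>Two jobs with coprime periods always collide. A symbol without attribute
  \<open>k\<close> must therefore also share a factor with the blockers of \<open>k\<close>, which
  is the purpose of \<open>b k\<close>, and blockers of different attributes need the common factor
  \<open>e\<close>. The classes modulo \<open>e\<close> are pinned down by a pigeonhole argument, so
  each of the \<open>e\<close> attributes has its own blockers, even an attribute that occurs in no
  symbol. The main obstacle is that a schedule need not arrange the blockers as intended: they might
  cover more residues modulo \<open>a k\<close> and fewer modulo \<open>b k\<close>. Their number
  rules this out as soon as \<open>a k\<close> is almost twice as large as \<open>b k\<close>. All
  moduli must be polynomial in \<open>e\<close>, since the blockers are listed one by one and the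
  primes are found by unary search. This requires an explicit lower bound on the number of primes.
  Only the periods of the symbols are exponentially large, and they arise as products of small
  factors, so binary times unary is the only multiplication of long numbers.\<close>

datatype prog =
    Push nat nat
  | Dup nat nat
  | Pop nat
  | Seq prog prog
  | If nat nat prog prog
  | While nat prog

text \<open>
  The value \<open>0\<close> of the blank stands for the top of the empty stack.
\<close>

definition top0 :: "nat list \<Rightarrow> nat" where
  "top0 xs = (if xs = [] then 0 else hd xs)"

text \<open>The time is the exact number of steps of the compiled machine: a push takes two because
  the head first moves left and then writes, and a test takes one. \<open>Dup\<close> must not read
  an empty stack, as it would write a blank.\<close>

inductive exec :: "prog \<Rightarrow> (nat \<Rightarrow> nat list) \<Rightarrow> nat \<Rightarrow> (nat \<Rightarrow> nat list) \<Rightarrow> bool" where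
  Push: "exec (Push v a) s 2 (s(v := a # s v))"
| Dup: "s u \<noteq> [] \<Longrightarrow> exec (Dup u v) s 2 (s(v := hd (s u) # s v))"
| Pop: "exec (Pop v) s 1 (s(v := tl (s v)))"
| Seq: "exec P s t s' \<Longrightarrow> exec Q s' t' s'' \<Longrightarrow> exec (Seq P Q) s (t + t') s''"
| If_True: "top0 (s v) = a \<Longrightarrow> exec P s t s' \<Longrightarrow> exec (If v a P Q) s (Suc t) s'"
| If_False: "top0 (s v) \<noteq> a \<Longrightarrow> exec Q s t s' \<Longrightarrow> exec (If v a P Q) s (Suc t) s'"
| While_False: "s v = [] \<Longrightarrow> exec (While v P) s 1 s"
| While_True: "s v \<noteq> [] \<Longrightarrow> exec P s t s' \<Longrightarrow> exec (While v P) s' t' s'' \<Longrightarrow>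
    exec (While v P) s (Suc (t + t')) s''"

text \<open>\<open>Dup\<close> needs two different stacks because its code moves the head of
  \<open>v\<close> before it reads \<open>u\<close>.\<close>

fun wf_prog :: "nat \<Rightarrow> nat \<Rightarrow> prog \<Rightarrow> bool" where
  "wf_prog K G (Push v a) \<longleftrightarrow> v < K \<and> 0 < a \<and> a < G"
| "wf_prog K G (Dup u v) \<longleftrightarrow> u < K \<and> v < K \<and> u \<noteq> v"
| "wf_prog K G (Pop v) \<longleftrightarrow> v < K"
| "wf_prog K G (Seq P Q) \<longleftrightarrow> wf_prog K G P \<and> wf_prog K G Q"
| "wf_prog K G (If v a P Q) \<longleftrightarrow> v < K \<and> wf_prog K G P \<and> wf_prog K G Q"
| "wf_prog K G (While v P) \<longleftrightarrow> v < K \<and> wf_prog K G P"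

lemma wf_prog_mono: "wf_prog K G P \<Longrightarrow> K \<le> K' \<Longrightarrow> wf_prog K' G P"
  by (induction P) auto

fun psize :: "prog \<Rightarrow> nat" where
  "psize (Push v a) = 2"
| "psize (Dup u v) = 2"
| "psize (Pop v) = 1"
| "psize (Seq P Q) = psize P + psize Q"
| "psize (If v a P Q) = Suc (psize P + psize Q)"
| "psize (While v P) = Suc (psize P)"

lemma psize_pos: "psize P > 0"
  by (induction P) auto

definition idle :: "nat list \<Rightarrow> (nat \<times> int) list" where
  "idle rs = map (\<lambda>r. (r, 0)) rs"

text \<open>A program occupies the states below \<open>psize P\<close> and leaves by entering state
  \<open>psize P\<close>. In \<open>Seq\<close> the exit of \<open>P\<close> already is the start of
  \<open>Q\<close>; in \<open>If\<close> the exit of \<open>P\<close> is redirected behind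
  \<open>Q\<close>, and in \<open>While\<close> back to the test.\<close>

fun code :: "prog \<Rightarrow> nat \<Rightarrow> nat list \<Rightarrow> nat \<times> (nat \<times> int) list" where
  "code (Push v a) q rs =
     (if q = 0 then (1, (idle rs)[v := (rs ! v, - 1)]) else (2, (idle rs)[v := (a, 0)]))"
| "code (Dup u v) q rs =
     (if q = 0 then (1, (idle rs)[v := (rs ! v, - 1)]) else (2, (idle rs)[v := (rs ! u, 0)]))"
| "code (Pop v) q rs = (1, (idle rs)[v := (0, 1)])"
| "code (Seq P Q) q rs =
     (if q < psize P then code P q rs
      else map_prod (\<lambda>q'. q' + psize P) id (code Q (q - psize P) rs))"
| "code (If v a P Q) q rs =
     (if q = 0 then (if rs ! v = a then 1 else Suc (psize P), idle rs)
      else if q \<le> psize P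
      then map_prod (\<lambda>q'. if q' = psize P then Suc (psize P + psize Q) else Suc q') id
             (code P (q - 1) rs)
      else map_prod (\<lambda>q'. Suc (q' + psize P)) id (code Q (q - Suc (psize P)) rs))"
| "code (While v P) q rs =
     (if q = 0 then (if rs ! v \<noteq> 0 then 1 else Suc (psize P), idle rs)
      else map_prod (\<lambda>q'. if q' = psize P then 0 else Suc q') id (code P (q - 1) rs))"

definition prog_tm :: "nat \<Rightarrow> nat \<Rightarrow> prog \<Rightarrow> tm" where
  "prog_tm K G P = \<lparr>num_tapes = K, num_symbols = G, num_states = psize P, delta = code P\<rparr>"

lemma in_set_idle_update: "x \<in> set ((idle rs)[v := y]) \<Longrightarrow> x = y \<or> (\<exists>r \<in> set rs. x = (r, 0))"
  by (drule set_mp[OF set_update_subset_insert]) (auto simp: idle_def)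

lemma length_idle [simp]: "length (idle rs) = length rs"
  by (simp add: idle_def)

lemma code_wf:
  assumes "wf_prog K G P" "q < psize P" "length rs = K" "set rs \<subseteq> {..<G}"
  shows "fst (code P q rs) \<le> psize P \<and> length (snd (code P q rs)) = K \<and>
    (\<forall>(w, m) \<in> set (snd (code P q rs)). w < G \<and> m \<in> {-1, 0, 1})"
  using assms
proof (induction P arbitrary: q)
  case (Push v a)
  then have "v < length rs" by simp
  then have "rs ! v < G" using Push.prems(4) nth_mem by blast
  then show ?case using Push by (auto dest!: in_set_idle_update)
next
  case (Dup u v)
  then have "v < length rs" "u < length rs" by simp_all
  then have "rs ! v < G" "rs ! u < G" using Dup.prems(4) nth_mem by blast+
  then show ?case using Dup by (auto dest!: in_set_idle_update)
next
  case (Pop v)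
  then have "v < length rs" by simp
  then have "rs ! v < G" using Pop.prems(4) nth_mem by blast
  then show ?case using Pop by (auto dest!: in_set_idle_update)
next
  case (Seq P Q)
  show ?case
  proof (cases "q < psize P")
    case True
    then show ?thesis using Seq.IH(1)[of q] Seq.prems by (auto simp: trans_le_add1)
  next
    case False
    then show ?thesis using Seq.IH(2)[of "q - psize P"] Seq.prems by auto
  qed
next
  case (If v a P Q)
  consider "q = 0" | "q > 0" "q \<le> psize P" | "q > psize P" by linarith
  then show ?case
  proof cases
    case 1
    then show ?thesis using If.prems by (auto simp: idle_def)
  next
    case 2
    then show ?thesis using If.IH(1)[of "q - 1"] If.prems by (auto simp: trans_le_add1)
  next
    case 3
    then show ?thesis using If.IH(2)[of "q - Suc (psize P)"] If.prems by auto
  qed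
next
  case (While v P)
  show ?case
  proof (cases "q = 0")
    case True
    then show ?thesis using While.prems by (auto simp: idle_def)
  next
    case False
    then show ?thesis using While.IH(1)[of "q - 1"] While.prems by auto
  qed
qed

lemma wf_prog_tm:
  assumes "wf_prog K G P"  "K \<ge> 1" "G \<ge> 1"
  shows "wf_tm (prog_tm K G P)"
  unfolding wf_tm_def
proof (intro conjI allI impI)
  fix q rs
  assume "q < num_states (prog_tm K G P) \<and> length rs = num_tapes (prog_tm K G P) \<and>
    set rs \<subseteq> {..<num_symbols (prog_tm K G P)}"
  then show "case delta (prog_tm K G P) q rs of (q', as) \<Rightarrow>
      q' \<le> num_states (prog_tm K G P) \<and> length as = num_tapes (prog_tm K G P) \<and>
      (\<forall>(w, m) \<in> set as. w < num_symbols (prog_tm K G P) \<and> m \<in> {-1, 0, 1})"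
    using code_wf[OF assms(1), of q rs] by (cases "code P q rs") (auto simp: prog_tm_def)
qed (use assms in \<open>auto simp: prog_tm_def\<close>)

section \<open>Runs of program fragments and stacks on tapes\<close>

definition cstep :: "(nat \<Rightarrow> nat list \<Rightarrow> nat \<times> (nat \<times> int) list) \<Rightarrow> config \<Rightarrow> config" where
  "cstep f = (\<lambda>(q, ts). (fst (f q (map read_tape ts)), map2 act_tape (snd (f q (map read_tape ts))) ts))"

text \<open>Every step starts in a state below \<open>n\<close>, whereas the last state is
  arbitrary. The exit of a subprogram can thus be an ordinary state of the surrounding
  program.\<close>

inductive reach ::
    "nat \<Rightarrow> (nat \<Rightarrow> nat list \<Rightarrow> nat \<times> (nat \<times> int) list) \<Rightarrow> config \<Rightarrow> nat \<Rightarrow> config \<Rightarrow> bool"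
  for n f where
  refl: "reach n f c 0 c"
| step: "fst c < n \<Longrightarrow> reach n f (cstep f c) t c' \<Longrightarrow> reach n f c (Suc t) c'"

lemma reach_trans:
  "reach n f c t c' \<Longrightarrow> reach n f c' t' c'' \<Longrightarrow> reach n f c (t + t') c''"
  by (induction rule: reach.induct) (auto intro: reach.intros)

text \<open>No step starts in the exit state, so \<open>h\<close> has to respect transitions only
  below \<open>n\<close> and may send the exit anywhere; this closes branches and loops.\<close>

lemma reach_embed:
  assumes "reach n f c t c'"
    and "\<And>q. q < n \<Longrightarrow> h q < n'"
    and "\<And>q rs. q < n \<Longrightarrow> f' (h q) rs = map_prod h id (f q rs)"
  shows "reach n' f' (map_prod h id c) t (map_prod h id c')"
  using assms(1)
proof (induction rule: reach.induct)
  case (refl c)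
  show ?case by (rule reach.refl)
next
  case (step c t c')
  have "cstep f' (map_prod h id c) = map_prod h id (cstep f c)"
    using step.hyps(1) assms(3) by (cases c) (auto simp: cstep_def)
  moreover have "fst (map_prod h id c) < n'"
    using step.hyps(1) assms(2) by (cases c) simp
  ultimately show ?case using step.IH by (metis reach.step)
qed

lemma reach_prog_tm:
  "reach (psize P) (code P) c t c' \<Longrightarrow> (tm_step (prog_tm K G P) ^^ t) c = c'"
proof (induction rule: reach.induct)
  case (step c t c')
  have "tm_step (prog_tm K G P) c = cstep (code P) c"
    using step.hyps(1) by (cases c) (auto simp: tm_step_def cstep_def prog_tm_def split: prod.splits)
  then show ?case using step by (simp add: funpow_swap1)
qed simp

text \<open>The stack grows to the left, so \<open>h\<close> drifts during a run and is quantified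
  away in \<open>represents\<close>. All other cells are blank, which makes the empty stack
  detectable.\<close>

definition stack_tape :: "nat list \<Rightarrow> int \<Rightarrow> tape" where
  "stack_tape xs h = (\<lambda>i. if h \<le> i \<and> i < h + int (length xs) then xs ! nat (i - h) else 0, h)"

lemma input_tape_eq: "input_tape xs = stack_tape xs 0"
  by (auto simp: input_tape_def stack_tape_def)

lemma read_stack_tape: "read_tape (stack_tape xs h) = top0 xs"
  by (cases xs) (auto simp: read_tape_def stack_tape_def top0_def)

lemma act_push: "act_tape (a, 0) (act_tape (top0 xs, - 1) (stack_tape xs h)) = stack_tape (a # xs) (h - 1)"
proof -
  have "nat (i - (h - 1)) = Suc (nat (i - h))" if "h \<le> i" for i
    using that by linarith
  moreover have "\<not> h \<le> i \<Longrightarrow> h - 1 \<le> i \<Longrightarrow> i = h - 1" for i by simp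
  ultimately show ?thesis
    by (cases xs) (auto simp: act_tape_def stack_tape_def top0_def fun_eq_iff)
qed

lemma act_pop: "act_tape (0, 1) (stack_tape xs h) = stack_tape (tl xs) (h + 1)"
proof (cases xs)
  case (Cons a ys)
  have "nat (i - h) = Suc (nat (i - (h + 1)))" if "h \<le> i" "i \<noteq> h" for i
    using that by linarith
  then show ?thesis using Cons by (auto simp: act_tape_def stack_tape_def fun_eq_iff)
qed (auto simp: act_tape_def stack_tape_def)

definition represents :: "nat \<Rightarrow> (nat \<Rightarrow> nat list) \<Rightarrow> tape list \<Rightarrow> bool" where
  "represents K s ts \<longleftrightarrow> length ts = K \<and> (\<forall>v<K. \<exists>h. ts ! v = stack_tape (s v) h)"

lemma represents_update:
  "represents K s ts \<Longrightarrow> represents K (s(v := xs)) (ts[v := stack_tape xs h])"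
  by (auto simp: represents_def nth_list_update)

lemma represents_read:
  "represents K s ts \<Longrightarrow> v < K \<Longrightarrow> map read_tape ts ! v = top0 (s v)"
  by (auto simp: represents_def read_stack_tape dest!: spec[of _ v])

lemma map2_idle: "map2 act_tape (idle (map read_tape ts)) ts = ts"
  by (rule nth_equalityI) (auto simp: idle_def act_tape_def read_tape_def split: prod.splits)

lemma map2_idle_update:
  "v < length ts \<Longrightarrow>
   map2 act_tape ((idle (map read_tape ts))[v := x]) ts = ts[v := act_tape x (ts ! v)]"
  by (rule nth_equalityI)
    (auto simp: idle_def act_tape_def read_tape_def nth_list_update split: prod.splits)

lemma exec_no_blank:
  "exec P s t s' \<Longrightarrow> wf_prog K G P \<Longrightarrow> (\<And>v. 0 \<notin> set (s v)) \<Longrightarrow> 0 \<notin> set (s' v)"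
proof (induction arbitrary: v rule: exec.induct)
  case (Dup s u w)
  then show ?case by (metis fun_upd_apply hd_in_set set_ConsD)
next
  case (Pop w s)
  then show ?case by (metis fun_upd_apply list.set_sel(2) tl_Nil)
qed auto

text \<open>Induction on the execution, embedding the runs of the parts. The absence of blanks is
  needed for \<open>While\<close>: its code compares with the blank, its semantics asks for the
  empty stack.\<close>

lemma reach_code:
  assumes "exec P s t s'" "wf_prog K G P" "\<And>v. 0 \<notin> set (s v)" "represents K s ts"
  shows "\<exists>ts'. represents K s' ts' \<and> reach (psize P) (code P) (0, ts) t (psize P, ts')"
  using assms
proof (induction arbitrary: ts rule: exec.induct)
  case (Push v a s)
  let ?ts1 = "ts[v := act_tape (top0 (s v), - 1) (ts ! v)]"
  obtain h where h: "ts ! v = stack_tape (s v) h" and v: "v < length ts"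
    using Push by (auto simp: represents_def)
  have "cstep (code (Push v a)) (0, ts) = (1, ?ts1)"
    using represents_read[OF Push.prems(3), of v] v
    by (simp add: cstep_def map2_idle_update h read_stack_tape)
  moreover have "cstep (code (Push v a)) (1, ?ts1) = (2, ts[v := stack_tape (a # s v) (h - 1)])"
    using v by (simp add: cstep_def map2_idle_update h act_push)
  ultimately have "reach 2 (code (Push v a)) (0, ts) 2 (2, ts[v := stack_tape (a # s v) (h - 1)])"
    by (auto simp: numeral_2_eq_2 intro!: reach.intros)
  then show ?case using represents_update[OF Push.prems(3)] by (metis psize.simps(1))
next
  case (Dup s u v)
  let ?ts1 = "ts[v := act_tape (top0 (s v), - 1) (ts ! v)]"
  obtain h where h: "ts ! v = stack_tape (s v) h" and v: "v < length ts" "u < length ts" "u \<noteq> v"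
    using Dup by (auto simp: represents_def)
  have "cstep (code (Dup u v)) (0, ts) = (1, ?ts1)"
    using represents_read[OF Dup.prems(3), of v] v
    by (simp add: cstep_def map2_idle_update h read_stack_tape)
  moreover have "map read_tape ?ts1 ! u = hd (s u)"
    using represents_read[OF Dup.prems(3), of u] v Dup by (simp add: top0_def)
  then have "cstep (code (Dup u v)) (1, ?ts1) = (2, ts[v := stack_tape (hd (s u) # s v) (h - 1)])"
    using v by (simp add: cstep_def map2_idle_update h act_push)
  ultimately have "reach 2 (code (Dup u v)) (0, ts) 2 (2, ts[v := stack_tape (hd (s u) # s v) (h - 1)])"
    by (auto simp: numeral_2_eq_2 intro!: reach.intros)
  then show ?case using represents_update[OF Dup.prems(3)] by (metis psize.simps(2))
next
  case (Pop v s)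
  obtain h where h: "ts ! v = stack_tape (s v) h" and v: "v < length ts"
    using Pop by (auto simp: represents_def)
  have "cstep (code (Pop v)) (0, ts) = (1, ts[v := stack_tape (tl (s v)) (h + 1)])"
    using v by (simp add: cstep_def map2_idle_update h act_pop)
  then have "reach 1 (code (Pop v)) (0, ts) 1 (1, ts[v := stack_tape (tl (s v)) (h + 1)])"
    by (metis One_nat_def fst_conv lessI reach.refl reach.step)
  then show ?case using represents_update[OF Pop.prems(3)] by (metis psize.simps(3))
next
  case (Seq P s t s' Q t' s'')
  obtain ts' where 1: "represents K s' ts'" "reach (psize P) (code P) (0, ts) t (psize P, ts')"
    using Seq.IH(1)[of ts] Seq.prems by fastforce
  have "0 \<notin> set (s' v)" for v using exec_no_blank[OF Seq.hyps(1)] Seq.prems by auto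
  then obtain ts'' where 2: "represents K s'' ts''"
      "reach (psize Q) (code Q) (0, ts') t' (psize Q, ts'')"
    using Seq.IH(2)[of ts'] Seq.prems 1(1) by fastforce
  have "reach (psize (Seq P Q)) (code (Seq P Q)) (map_prod id id (0, ts)) t (map_prod id id (psize P, ts'))"
    by (rule reach_embed[OF 1(2)]) (auto simp: prod.map_id)
  moreover have "reach (psize (Seq P Q)) (code (Seq P Q))
      (map_prod (\<lambda>q. q + psize P) id (0, ts')) t' (map_prod (\<lambda>q. q + psize P) id (psize Q, ts''))"
    by (rule reach_embed[OF 2(2)]) auto
  ultimately have "reach (psize (Seq P Q)) (code (Seq P Q)) (0, ts) (t + t') (psize (Seq P Q), ts'')"
    by (auto simp: add.commute simp del: code.simps dest: reach_trans)
  then show ?case using 2(1) by blast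
next
  case (If_True s v a P t s' Q)
  obtain ts' where 1: "represents K s' ts'" "reach (psize P) (code P) (0, ts) t (psize P, ts')"
    using If_True.IH[of ts] If_True.prems by fastforce
  let ?h = "\<lambda>q'. if q' = psize P then Suc (psize P + psize Q) else Suc q'"
  have "reach (psize (If v a P Q)) (code (If v a P Q)) (map_prod ?h id (0, ts)) t (map_prod ?h id (psize P, ts'))"
    by (rule reach_embed[OF 1(2)]) auto
  moreover have "cstep (code (If v a P Q)) (0, ts) = (1, ts)"
    using If_True represents_read[of K s ts v] by (simp add: cstep_def map2_idle)
  ultimately have "reach (psize (If v a P Q)) (code (If v a P Q)) (0, ts) (Suc t) (psize (If v a P Q), ts')"
    using psize_pos[of P] by (auto intro!: reach.step)
  then show ?case using 1(1) by blast
next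
  case (If_False s v a Q t s' P)
  obtain ts' where 1: "represents K s' ts'" "reach (psize Q) (code Q) (0, ts) t (psize Q, ts')"
    using If_False.IH[of ts] If_False.prems by fastforce
  let ?h = "\<lambda>q'. Suc (q' + psize P)"
  have "reach (psize (If v a P Q)) (code (If v a P Q)) (map_prod ?h id (0, ts)) t (map_prod ?h id (psize Q, ts'))"
    by (rule reach_embed[OF 1(2)]) auto
  moreover have "cstep (code (If v a P Q)) (0, ts) = (Suc (psize P), ts)"
    using If_False represents_read[of K s ts v] by (simp add: cstep_def map2_idle)
  ultimately have "reach (psize (If v a P Q)) (code (If v a P Q)) (0, ts) (Suc t) (psize (If v a P Q), ts')"
    by (auto intro!: reach.step simp: add.commute)
  then show ?case using 1(1) by blast
next
  case (While_False s v P)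
  have "cstep (code (While v P)) (0, ts) = (Suc (psize P), ts)"
    using While_False represents_read[of K s ts v] by (simp add: cstep_def map2_idle top0_def)
  then have "reach (psize (While v P)) (code (While v P)) (0, ts) (Suc 0) (psize (While v P), ts)"
    by (auto intro!: reach.intros)
  then show ?case using While_False.prems(3) by (metis One_nat_def)
next
  case (While_True s v P t s' t' s'')
  obtain ts' where 1: "represents K s' ts'" "reach (psize P) (code P) (0, ts) t (psize P, ts')"
    using While_True.IH(1)[of ts] While_True.prems by fastforce
  have "0 \<notin> set (s' v)" for v using exec_no_blank[OF While_True.hyps(2)] While_True.prems by auto
  then obtain ts'' where 2: "represents K s'' ts''"
      "reach (psize (While v P)) (code (While v P)) (0, ts') t' (psize (While v P), ts'')"
    using While_True.IH(2)[of ts'] While_True.prems 1(1) by fastforce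
  \<comment> \<open>The exit of the body becomes the test state \<open>0\<close>, where the run of
    the remaining rounds starts.\<close>
  let ?h = "\<lambda>q'. if q' = psize P then 0 else Suc q'"
  have 3: "reach (psize (While v P)) (code (While v P)) (map_prod ?h id (0, ts)) t (map_prod ?h id (psize P, ts'))"
    by (rule reach_embed[OF 1(2)]) auto
  have "top0 (s v) \<noteq> 0"
    using While_True.hyps(1) While_True.prems(2)[of v] by (metis hd_in_set top0_def)
  then have "cstep (code (While v P)) (0, ts) = (1, ts)"
    using While_True.prems represents_read[of K s ts v] by (simp add: cstep_def map2_idle)
  then have "reach (psize (While v P)) (code (While v P)) (0, ts) (Suc (t + t')) (psize (While v P), ts'')"
    using reach_trans[OF 3] 2(2) psize_pos[of P] by (auto intro!: reach.step)
  then show ?case using 2(1) by blast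
qed

theorem prog_tm_computes:
  assumes "exec P ((\<lambda>_. [])(0 := xs)) t s'" "wf_prog K G P" "K \<ge> 1"
    and "set xs \<subseteq> {1..<G}" "t \<le> b"
  shows "tm_computes_within (prog_tm K G P) xs (s' 0) b"
proof -
  let ?s = "(\<lambda>_. [])(0 := xs)"
  let ?ts = "input_tape xs # replicate (K - 1) (input_tape [])"
  have "\<exists>h. ?ts ! v = stack_tape (?s v) h" if "v < K" for v
    using that by (cases v) (auto simp: input_tape_eq)
  then have "represents K ?s ?ts" using assms(3) by (simp add: represents_def)
  moreover have nz: "0 \<notin> set (?s v)" for v using assms(4) by auto
  ultimately obtain ts' where ts': "represents K s' ts'"
      "reach (psize P) (code P) (0, ?ts) t (psize P, ts')"
    using reach_code[OF assms(1,2)] by blast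
  have "0 \<notin> set (s' 0)" using exec_no_blank[OF assms(1,2)] nz by blast
  moreover obtain h where "hd ts' = stack_tape (s' 0) h"
    using ts'(1) assms(3) by (cases ts') (auto simp: represents_def)
  ultimately have "output_on (hd ts') (s' 0)"
    by (auto simp: output_on_def stack_tape_def)
  moreover have "(tm_step (prog_tm K G P) ^^ t) (tm_init (prog_tm K G P) xs) = (psize P, ts')"
    using reach_prog_tm[OF ts'(2)] by (simp add: tm_init_def prog_tm_def)
  ultimately show ?thesis
    using assms(4,5) by (auto simp: tm_computes_within_def prog_tm_def)
qed

section \<open>Functions computable in polynomial time\<close>

lemma poly_nat_mono: "x \<le> y \<Longrightarrow> poly p x \<le> poly p y" for p :: "nat poly"
  by (induction p) (auto intro!: add_mono mult_mono)

text \<open>Each pushed symbol costs time, so time bounds are also length bounds.\<close>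

lemma exec_length: "exec P s t s' \<Longrightarrow> length (s' v) \<le> length (s v) + t"
  by (induction rule: exec.induct) auto

definition exec_le :: "prog \<Rightarrow> (nat \<Rightarrow> nat list) \<Rightarrow> nat \<Rightarrow> (nat \<Rightarrow> nat list) \<Rightarrow> bool" where
  "exec_le P s b s' \<longleftrightarrow> (\<exists>t \<le> b. exec P s t s')"

lemma exec_le_mono: "exec_le P s b s' \<Longrightarrow> b \<le> b' \<Longrightarrow> exec_le P s b' s'"
  unfolding exec_le_def by (meson order_trans)

lemma exec_le_length: "exec_le P s b s' \<Longrightarrow> length (s' v) \<le> length (s v) + b"
  unfolding exec_le_def using exec_length by (meson add_left_mono order_trans)

lemma exec_le_Seq: "exec_le P s b s' \<Longrightarrow> exec_le Q s' b' s'' \<Longrightarrow> exec_le (Seq P Q) s (b + b') s''"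
  unfolding exec_le_def by (meson add_mono exec.Seq)

lemma exec_le_Push: "exec_le (Push v a) s 2 (s(v := a # s v))"
  unfolding exec_le_def using exec.Push by blast

lemma exec_le_Dup: "s u \<noteq> [] \<Longrightarrow> exec_le (Dup u v) s 2 (s(v := hd (s u) # s v))"
  unfolding exec_le_def using exec.Dup by blast

lemma exec_le_Pop: "exec_le (Pop v) s 1 (s(v := tl (s v)))"
  unfolding exec_le_def using exec.Pop by blast

lemma exec_le_If:
  assumes "top0 (s v) = a \<Longrightarrow> exec_le P s b s'" "top0 (s v) \<noteq> a \<Longrightarrow> exec_le Q s b s'"
  shows "exec_le (If v a P Q) s (Suc b) s'"
proof (cases "top0 (s v) = a")
  case True
  then obtain t where "t \<le> b" "exec P s t s'" using assms(1) unfolding exec_le_def by blast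
  then show ?thesis using exec.If_True[of s v a, OF True] unfolding exec_le_def by (meson Suc_le_mono)
next
  case False
  then obtain t where "t \<le> b" "exec Q s t s'" using assms(2) unfolding exec_le_def by blast
  then show ?thesis using exec.If_False[of s v a, OF False] unfolding exec_le_def by (meson Suc_le_mono)
qed

lemma exec_le_While:
  assumes "\<And>i. i < n \<Longrightarrow> S i v \<noteq> []" "S n v = []"
    and "\<And>i. i < n \<Longrightarrow> exec_le P (S i) b (S (Suc i))"
  shows "exec_le (While v P) (S 0) (Suc (n * Suc b)) (S n)"
  using assms
proof (induction n arbitrary: S)
  case 0
  then show ?case unfolding exec_le_def using exec.While_False[of "S 0" v P] by auto
next
  case (Suc n)
  obtain t where t: "t \<le> b" "exec P (S 0) t (S 1)"
    using Suc.prems(3)[of 0] by (auto simp: exec_le_def)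
  have "exec_le (While v P) (S (Suc 0)) (Suc (n * Suc b)) (S (Suc n))"
    using Suc.IH[of "\<lambda>i. S (Suc i)"] Suc.prems by auto
  then obtain t' where t': "t' \<le> Suc (n * Suc b)" "exec (While v P) (S 1) t' (S (Suc n))"
    by (auto simp: exec_le_def)
  have "exec (While v P) (S 0) (Suc (t + t')) (S (Suc n))"
    using exec.While_True[OF _ t(2) t'(2)] Suc.prems(1)[of 0] by simp
  moreover have "Suc (t + t') \<le> Suc (Suc n * Suc b)"
    using t(1) t'(1) by simp
  ultimately show ?case unfolding exec_le_def by blast
qed

definition clear :: "nat \<Rightarrow> prog" where
  "clear v = While v (Pop v)"

lemma exec_le_clear: "exec_le (clear v) s (2 * length (s v) + 1) (s(v := []))"
proof -
  have "exec_le (clear v) (s(v := drop 0 (s v))) (Suc (length (s v) * Suc 1))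
      (s(v := drop (length (s v)) (s v)))"
    unfolding clear_def
  proof (rule exec_le_While)
    fix i
    show "exec_le (Pop v) (s(v := drop i (s v))) 1 (s(v := drop (Suc i) (s v)))"
      using exec_le_Pop[of v "s(v := drop i (s v))"] by (simp add: drop_Suc tl_drop)
  qed auto
  then show ?thesis by (simp add: mult_2 mult_2_right)
qed

definition move :: "nat \<Rightarrow> nat \<Rightarrow> prog" where
  "move u v = While u (Seq (Dup u v) (Pop u))"

lemma rev_take_Suc: "i < length xs \<Longrightarrow> rev (take (Suc i) xs) = xs ! i # rev (take i xs)"
  by (simp add: take_Suc_conv_app_nth)

lemma exec_le_move:
  assumes "u \<noteq> v"
  shows "exec_le (move u v) s (4 * length (s u) + 1) (s(u := [], v := rev (s u) @ s v))"
proof -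
  let ?S = "\<lambda>i. s(u := drop i (s u), v := rev (take i (s u)) @ s v)"
  have "exec_le (move u v) (?S 0) (Suc (length (s u) * Suc (2 + 1))) (?S (length (s u)))"
    unfolding move_def
  proof (rule exec_le_While)
    fix i assume i: "i < length (s u)"
    let ?s1 = "(?S i)(v := hd (?S i u) # ?S i v)"
    have 1: "exec_le (Dup u v) (?S i) 2 ?s1"
      by (rule exec_le_Dup) (use i assms in auto)
    have 2: "exec_le (Pop u) ?s1 1 (?s1(u := tl (?s1 u)))"
      by (rule exec_le_Pop)
    have 3: "?s1(u := tl (?s1 u)) = ?S (Suc i)"
      using i assms by (auto simp: fun_eq_iff rev_take_Suc hd_drop_conv_nth drop_Suc tl_drop)
    show "exec_le (Seq (Dup u v) (Pop u)) (?S i) (2 + 1) (?S (Suc i))"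
      by (rule exec_le_Seq[OF 1 2, unfolded 3])
  qed (use assms in auto)
  then show ?thesis by (simp add: mult.commute)
qed

text \<open>Undoes a \<open>move\<close> from \<open>u\<close> to \<open>w\<close> and leaves a copy
  in \<open>v\<close>; the two reversals cancel.\<close>

definition copy_back :: "nat \<Rightarrow> nat \<Rightarrow> nat \<Rightarrow> prog" where
  "copy_back w u v = While w (Seq (Dup w u) (Seq (Dup w v) (Pop w)))"

lemma exec_le_copy_back:
  assumes "u \<noteq> v" "u \<noteq> w" "v \<noteq> w"
  shows "exec_le (copy_back w u v) s (6 * length (s w) + 1)
    (s(w := [], u := rev (s w) @ s u, v := rev (s w) @ s v))"
proof -
  let ?S = "\<lambda>i. s(w := drop i (s w), u := rev (take i (s w)) @ s u, v := rev (take i (s w)) @ s v)"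
  have "exec_le (copy_back w u v) (?S 0) (Suc (length (s w) * Suc (2 + (2 + 1)))) (?S (length (s w)))"
    unfolding copy_back_def
  proof (rule exec_le_While)
    fix i assume i: "i < length (s w)"
    let ?s1 = "(?S i)(u := hd (?S i w) # ?S i u)"
    let ?s2 = "?s1(v := hd (?s1 w) # ?s1 v)"
    have 1: "exec_le (Dup w u) (?S i) 2 ?s1"
      by (rule exec_le_Dup) (use i assms in auto)
    have 2: "exec_le (Dup w v) ?s1 2 ?s2"
      by (rule exec_le_Dup) (use i assms in auto)
    have 3: "exec_le (Pop w) ?s2 1 (?s2(w := tl (?s2 w)))"
      by (rule exec_le_Pop)
    have 4: "?s2(w := tl (?s2 w)) = ?S (Suc i)"
      using i assms by (auto simp: fun_eq_iff rev_take_Suc hd_drop_conv_nth drop_Suc tl_drop)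
    show "exec_le (Seq (Dup w u) (Seq (Dup w v) (Pop w))) (?S i) (2 + (2 + 1)) (?S (Suc i))"
      by (rule exec_le_Seq[OF 1 exec_le_Seq[OF 2 3], unfolded 4])
  qed (use assms in auto)
  then show ?thesis by (simp add: mult.commute)
qed

text \<open>The detour through \<open>w\<close> restores the order that a single \<open>move\<close>
  would reverse.\<close>

definition replace :: "nat \<Rightarrow> nat \<Rightarrow> nat \<Rightarrow> prog" where
  "replace v u w = Seq (clear v) (Seq (move u w) (move w v))"

lemma exec_le_replace:
  assumes "u \<noteq> v" "u \<noteq> w" "v \<noteq> w" "s w = []"
  shows "exec_le (replace v u w) s (2 * length (s v) + 8 * length (s u) + 3) (s(v := s u, u := []))"
proof -
  let ?s1 = "s(v := [])"
  let ?s2 = "?s1(u := [], w := rev (?s1 u) @ ?s1 w)"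
  let ?s3 = "?s2(w := [], v := rev (?s2 w) @ ?s2 v)"
  have "exec_le (replace v u w) s
      ((2 * length (s v) + 1) + ((4 * length (?s1 u) + 1) + (4 * length (?s2 w) + 1))) ?s3"
    unfolding replace_def
    by (rule exec_le_Seq[OF exec_le_clear exec_le_Seq[OF exec_le_move exec_le_move]]) (use assms in auto)
  moreover have "?s3 = s(v := s u, u := [])"
    using assms by (auto simp: fun_eq_iff)
  moreover have "(2 * length (s v) + 1) + ((4 * length (?s1 u) + 1) + (4 * length (?s2 w) + 1))
      = 2 * length (s v) + 8 * length (s u) + 3"
    using assms by simp
  ultimately show ?thesis by metis
qed

lemma wf_prog_clear [simp]: "wf_prog K G (clear v) \<longleftrightarrow> v < K"
  by (auto simp: clear_def)

lemma wf_prog_move [simp]: "wf_prog K G (move u v) \<longleftrightarrow> u < K \<and> v < K \<and> u \<noteq> v"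
  by (auto simp: move_def)

lemma wf_prog_copy_back [simp]:
  "wf_prog K G (copy_back w u v) \<longleftrightarrow> w < K \<and> u < K \<and> v < K \<and> w \<noteq> u \<and> w \<noteq> v"
  by (auto simp: copy_back_def)

lemma wf_prog_replace [simp]:
  "wf_prog K G (replace v u w) \<longleftrightarrow> v < K \<and> u < K \<and> w < K \<and> u \<noteq> w \<and> v \<noteq> w"
  by (auto simp: replace_def)

section \<open>Closure properties of functions of a context\<close>

definition ctx_size :: "('c \<Rightarrow> nat list) list \<Rightarrow> 'c \<Rightarrow> nat" where
  "ctx_size \<Gamma> c = (\<Sum>g\<leftarrow>\<Gamma>. length (g c))"

definition layout :: "('c \<Rightarrow> nat list) list \<Rightarrow> 'c \<Rightarrow> nat list \<Rightarrow> nat \<Rightarrow> (nat \<Rightarrow> nat list) \<Rightarrow> bool" where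
  "layout \<Gamma> c vs k s \<longleftrightarrow> map s vs = map (\<lambda>g. g c) \<Gamma> \<and> (\<forall>v\<ge>k. s v = [])"

text \<open>The blank and the three symbols of the encodings.\<close>

definition nsym :: nat where "nsym = 4"

text \<open>
  The program \<open>P\<close> finds the values of the context \<open>\<Gamma>\<close> in the stacks \<open>vs\<close> and leaves the result in stack
  \<open>k\<close>; all stacks from \<open>k\<close> onwards are initially empty and serve as scratch space.
\<close>

definition implements ::
    "('c \<Rightarrow> nat list) list \<Rightarrow> ('c \<Rightarrow> nat list) \<Rightarrow> nat poly \<Rightarrow> nat \<Rightarrow> nat list \<Rightarrow> prog \<Rightarrow> bool" where
  "implements \<Gamma> f p k vs P \<longleftrightarrow> (\<exists>K. wf_prog K nsym P) \<and>
     (\<forall>c s. layout \<Gamma> c vs k s \<longrightarrow> exec_le P s (poly p (ctx_size \<Gamma> c)) (s(k := f c)))"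

text \<open>One polynomial serves all placements, so programs can be composed at shifted positions,
  with intermediate results kept below the scratch space.\<close>

definition pt :: "('c \<Rightarrow> nat list) list \<Rightarrow> ('c \<Rightarrow> nat list) \<Rightarrow> bool" where
  "pt \<Gamma> f \<longleftrightarrow> (\<exists>p. \<forall>k vs. length vs = length \<Gamma> \<and> set vs \<subseteq> {..<k} \<longrightarrow> (\<exists>P. implements \<Gamma> f p k vs P))"

lemma ptI:
  assumes "\<And>k vs. length vs = length \<Gamma> \<Longrightarrow> set vs \<subseteq> {..<k} \<Longrightarrow> \<exists>P. implements \<Gamma> f p k vs P"
  shows "pt \<Gamma> f"
  using assms unfolding pt_def by blast

lemma ptE:
  assumes "pt \<Gamma> f"
  obtains p where
    "\<And>k vs. length vs = length \<Gamma> \<Longrightarrow> set vs \<subseteq> {..<k} \<Longrightarrow> \<exists>P. implements \<Gamma> f p k vs P"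
  using assms unfolding pt_def by blast

lemma wf_prog_common:
  assumes "wf_prog K1 G P" "wf_prog K2 G Q"
  obtains K where "wf_prog K G P" "wf_prog K G Q" "K \<ge> K0"
  using assms wf_prog_mono[of _ G _ "max K0 (max K1 K2)"] by (metis max.cobounded1 max.cobounded2 max.coboundedI2)

lemma pt_length:
  assumes "pt \<Gamma> f"
  shows "\<exists>p. \<forall>c. length (f c) \<le> poly p (ctx_size \<Gamma> c)"
proof -
  obtain p where p: "\<And>k vs. length vs = length \<Gamma> \<Longrightarrow> set vs \<subseteq> {..<k} \<Longrightarrow> \<exists>P. implements \<Gamma> f p k vs P"
    using ptE[OF assms] by blast
  let ?k = "length \<Gamma>"
  have "set [0..<?k] \<subseteq> {..<?k}" by auto
  then obtain P where P: "implements \<Gamma> f p ?k [0..<?k] P"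
    using p[of "[0..<?k]" ?k] by force
  have "length (f c) \<le> poly p (ctx_size \<Gamma> c)" for c
  proof -
    define s where "s v = (if v < ?k then (\<Gamma> ! v) c else [])" for v
    have "layout \<Gamma> c [0..<?k] ?k s"
      by (auto simp: layout_def s_def intro!: nth_equalityI)
    then have "exec_le P s (poly p (ctx_size \<Gamma> c)) (s(?k := f c))"
      using P by (auto simp: implements_def)
    from exec_le_length[OF this, of ?k] show ?thesis by (simp add: s_def)
  qed
  then show ?thesis by blast
qed

lemma length_le_ctx_size: "g \<in> set \<Gamma> \<Longrightarrow> length (g c) \<le> ctx_size \<Gamma> c"
  unfolding ctx_size_def by (simp add: member_le_sum_list)

lemma pt_var:
  assumes "g \<in> set \<Gamma>"
  shows "pt \<Gamma> g"
proof (rule ptI[where p = "[:2, 10:]"])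
  fix k and vs :: "nat list"
  assume vs: "length vs = length \<Gamma>" "set vs \<subseteq> {..<k}"
  obtain i where i: "i < length \<Gamma>" "\<Gamma> ! i = g" using assms by (auto simp: in_set_conv_nth)
  define u where "u = vs ! i"
  have "u \<in> set vs" using i vs by (simp add: u_def)
  then have u: "u < k" using vs by auto
  let ?P = "Seq (move u (Suc k)) (copy_back (Suc k) u k)"
  have "wf_prog (Suc (Suc k)) nsym ?P" using u by simp
  moreover have "exec_le ?P s (poly [:2, 10:] (ctx_size \<Gamma> c)) (s(k := g c))" if "layout \<Gamma> c vs k s" for c s
  proof -
    have su: "s u = g c" "s k = []" "s (Suc k) = []"
      using that i vs unfolding layout_def u_def by (metis nth_map, auto)
    let ?s1 = "s(u := [], Suc k := rev (s u) @ s (Suc k))"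
    let ?s2 = "?s1(Suc k := [], u := rev (?s1 (Suc k)) @ ?s1 u, k := rev (?s1 (Suc k)) @ ?s1 k)"
    have "exec_le ?P s ((4 * length (s u) + 1) + (6 * length (?s1 (Suc k)) + 1)) ?s2"
      by (rule exec_le_Seq[OF exec_le_move exec_le_copy_back]) (use u in auto)
    moreover have "?s2 = s(k := g c)" using u su by (auto simp: fun_eq_iff)
    ultimately show ?thesis
      using length_le_ctx_size[OF assms, of c] su by (auto elim!: exec_le_mono)
  qed
  ultimately show "\<exists>P. implements \<Gamma> g [:2, 10:] k vs P"
    unfolding implements_def by blast
qed

lemma layout_extend:
  assumes "layout \<Gamma> c vs k s" "set vs \<subseteq> {..<k}"
  shows "layout \<Gamma> c vs (Suc k) (s(k := x))"
proof -
  have "map (s(k := x)) vs = map s vs" by (rule map_cong) (use assms(2) in auto)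
  then show ?thesis using assms(1) unfolding layout_def by simp
qed

lemma pt_nil: "pt \<Gamma> (\<lambda>_. [])"
proof (rule ptI[where p = "[:1:]"])
  fix k and vs :: "nat list"
  \<comment> \<open>\<open>Pop\<close> on the empty result stack is a program that changes
    nothing.\<close>
  have "wf_prog (Suc k) nsym (Pop k)" by simp
  moreover have "exec_le (Pop k) s 1 (s(k := []))" if "layout \<Gamma> c vs k s" for c s
    using exec_le_Pop[of k s] that by (simp add: layout_def)
  ultimately show "\<exists>P. implements \<Gamma> (\<lambda>_. []) [:1:] k vs P"
    unfolding implements_def by (auto intro!: exI[of _ "Pop k"])
qed

lemma pt_post:
  assumes "pt \<Gamma> f" "\<And>k. wf_prog (Suc k) nsym (P k)" "\<And>k s. exec_le (P k) s b (s(k := h (s k)))"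
  shows "pt \<Gamma> (\<lambda>c. h (f c))"
proof -
  obtain p where p: "\<And>k vs. length vs = length \<Gamma> \<Longrightarrow> set vs \<subseteq> {..<k} \<Longrightarrow> \<exists>P. implements \<Gamma> f p k vs P"
    using ptE[OF assms(1)] by blast
  show ?thesis
  proof (rule ptI)
    fix k and vs :: "nat list"
    assume vs: "length vs = length \<Gamma>" "set vs \<subseteq> {..<k}"
    obtain Q where Q: "implements \<Gamma> f p k vs Q" using p vs by blast
    obtain K where "wf_prog K nsym (P k)" "wf_prog K nsym Q"
      using Q assms(2) wf_prog_common[of _ nsym "P k" _ Q 0] unfolding implements_def by metis
    then have "wf_prog K nsym (Seq Q (P k))" by simp
    moreover have "exec_le (Seq Q (P k)) s (poly (p + [:b:]) (ctx_size \<Gamma> c)) (s(k := h (f c)))"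
      if lay: "layout \<Gamma> c vs k s" for c s
    proof -
      have "exec_le Q s (poly p (ctx_size \<Gamma> c)) (s(k := f c))"
        using Q lay by (auto simp: implements_def)
      from exec_le_Seq[OF this assms(3)[of k]] show ?thesis by simp
    qed
    ultimately show "\<exists>P. implements \<Gamma> (\<lambda>c. h (f c)) (p + [:b:]) k vs P"
      unfolding implements_def by blast
  qed
qed

lemma pt_Cons: "pt \<Gamma> f \<Longrightarrow> 0 < a \<Longrightarrow> a < nsym \<Longrightarrow> pt \<Gamma> (\<lambda>c. a # f c)"
  by (rule pt_post[where P = "\<lambda>k. Push k a" and h = "\<lambda>xs. a # xs" and b = 2]) (use exec_le_Push in auto)

lemma pt_tl: "pt \<Gamma> f \<Longrightarrow> pt \<Gamma> (\<lambda>c. tl (f c))"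
  by (rule pt_post[where P = "Pop" and h = "\<lambda>xs. tl xs" and b = 1]) (use exec_le_Pop in auto)

lemma pt_append:
  assumes "pt \<Gamma> f" "pt \<Gamma> g"
  shows "pt \<Gamma> (\<lambda>c. f c @ g c)"
proof -
  obtain p where p: "\<And>k vs. length vs = length \<Gamma> \<Longrightarrow> set vs \<subseteq> {..<k} \<Longrightarrow> \<exists>P. implements \<Gamma> f p k vs P"
    using ptE[OF assms(1)] by blast
  obtain q where q: "\<And>k vs. length vs = length \<Gamma> \<Longrightarrow> set vs \<subseteq> {..<k} \<Longrightarrow> \<exists>P. implements \<Gamma> g q k vs P"
    using ptE[OF assms(2)] by blast
  obtain l where l: "\<And>c. length (f c) \<le> poly l (ctx_size \<Gamma> c)" using pt_length[OF assms(1)] by blast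
  let ?r = "q + (p + (8 * l + 2))"
  show ?thesis
  proof (rule ptI)
    fix k and vs :: "nat list"
    assume vs: "length vs = length \<Gamma>" "set vs \<subseteq> {..<k}"
    obtain Q where Q: "implements \<Gamma> g q k vs Q" using q vs by blast
    have vs': "set vs \<subseteq> {..<Suc k}" using vs(2) by auto
    then obtain P where P: "implements \<Gamma> f p (Suc k) vs P" using p vs(1) by blast
    let ?k = "Suc (Suc k)"
    \<comment> \<open>The second argument is computed first and lies at the bottom; the first one is
      reversed twice on its way onto it.\<close>
    let ?M = "Seq (move (Suc k) ?k) (move ?k k)"
    obtain K where "wf_prog K nsym P" "wf_prog K nsym Q" "K \<ge> k + 3"
      using P Q wf_prog_common[of _ nsym P _ Q "k + 3"] unfolding implements_def by metis
    then have "wf_prog K nsym (Seq Q (Seq P ?M))" by simp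
    moreover have "exec_le (Seq Q (Seq P ?M)) s (poly ?r (ctx_size \<Gamma> c)) (s(k := f c @ g c))"
      if lay: "layout \<Gamma> c vs k s" for c s
    proof -
      let ?s1 = "s(k := g c)"
      let ?s2 = "?s1(Suc k := f c)"
      let ?s3 = "?s2(Suc k := [], ?k := rev (?s2 (Suc k)) @ ?s2 ?k)"
      let ?s4 = "?s3(?k := [], k := rev (?s3 ?k) @ ?s3 k)"
      have 1: "exec_le Q s (poly q (ctx_size \<Gamma> c)) ?s1"
        using Q lay by (auto simp: implements_def)
      have 2: "exec_le P ?s1 (poly p (ctx_size \<Gamma> c)) ?s2"
        using P layout_extend[OF lay vs(2)] by (auto simp: implements_def)
      have "exec_le ?M ?s2 ((4 * length (?s2 (Suc k)) + 1) + (4 * length (?s3 ?k) + 1)) ?s4"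
        by (rule exec_le_Seq[OF exec_le_move exec_le_move]) auto
      then have 3: "exec_le ?M ?s2 (poly (8 * l + 2) (ctx_size \<Gamma> c)) ?s4"
        by (rule exec_le_mono) (use l[of c] lay in \<open>simp add: layout_def\<close>)
      have "?s4 = s(k := f c @ g c)" using lay by (auto simp: fun_eq_iff layout_def)
      then show ?thesis using exec_le_Seq[OF 1 exec_le_Seq[OF 2 3]] by (simp only: poly_add)
    qed
    ultimately show "\<exists>P. implements \<Gamma> (\<lambda>c. f c @ g c) ?r k vs P" unfolding implements_def by blast
  qed
qed

lemma pt_if_top:
  assumes "pt \<Gamma> t" "pt \<Gamma> f" "pt \<Gamma> g"
  shows "pt \<Gamma> (\<lambda>c. if top0 (t c) = a then f c else g c)"
proof -
  let ?h = "\<lambda>c. if top0 (t c) = a then f c else g c"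
  obtain p where p: "\<And>k vs. length vs = length \<Gamma> \<Longrightarrow> set vs \<subseteq> {..<k} \<Longrightarrow> \<exists>P. implements \<Gamma> f p k vs P"
    using ptE[OF assms(2)] by blast
  obtain q where q: "\<And>k vs. length vs = length \<Gamma> \<Longrightarrow> set vs \<subseteq> {..<k} \<Longrightarrow> \<exists>P. implements \<Gamma> g q k vs P"
    using ptE[OF assms(3)] by blast
  obtain r where r: "\<And>k vs. length vs = length \<Gamma> \<Longrightarrow> set vs \<subseteq> {..<k} \<Longrightarrow> \<exists>P. implements \<Gamma> t r k vs P"
    using ptE[OF assms(1)] by blast
  obtain l where l: "\<And>c. length (f c) \<le> poly l (ctx_size \<Gamma> c)" using pt_length[OF assms(2)] by blast
  obtain m where m: "\<And>c. length (g c) \<le> poly m (ctx_size \<Gamma> c)" using pt_length[OF assms(3)] by blast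
  obtain n where n: "\<And>c. length (t c) \<le> poly n (ctx_size \<Gamma> c)" using pt_length[OF assms(1)] by blast
  let ?r = "r + ((p + q + 1) + (2 * n + 8 * (l + m) + 3))"
  show ?thesis
  proof (rule ptI)
    fix k and vs :: "nat list"
    assume vs: "length vs = length \<Gamma>" "set vs \<subseteq> {..<k}"
    obtain R where R: "implements \<Gamma> t r k vs R" using r vs by blast
    have vs': "set vs \<subseteq> {..<Suc k}" using vs(2) by auto
    then obtain P where P: "implements \<Gamma> f p (Suc k) vs P" using p vs(1) by blast
    obtain Q where Q: "implements \<Gamma> g q (Suc k) vs Q" using q vs(1) vs' by blast
    let ?I = "If k a P Q"
    let ?M = "replace k (Suc k) (Suc (Suc k))"
    obtain K' where K': "wf_prog K' nsym P" "wf_prog K' nsym Q" "K' \<ge> k + 3"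
      using P Q wf_prog_common[of _ nsym P _ Q "k + 3"] unfolding implements_def by metis
    then have "wf_prog K' nsym (Seq ?I ?M)" by simp
    then obtain K where "wf_prog K nsym R" "wf_prog K nsym (Seq ?I ?M)"
      using R wf_prog_common[of _ nsym R _ "Seq ?I ?M" 0] unfolding implements_def by metis
    then have "wf_prog K nsym (Seq R (Seq ?I ?M))" by simp
    moreover have "exec_le (Seq R (Seq ?I ?M)) s (poly ?r (ctx_size \<Gamma> c)) (s(k := ?h c))"
      if lay: "layout \<Gamma> c vs k s" for c s
    proof -
      let ?s1 = "s(k := t c)"
      let ?s2 = "?s1(Suc k := ?h c)"
      let ?s3 = "?s2(k := ?s2 (Suc k), Suc k := [])"
      let ?z = "ctx_size \<Gamma> c"
      have 1: "exec_le R s (poly r ?z) ?s1"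
        using R lay by (auto simp: implements_def)
      have "exec_le P ?s1 (poly p ?z) (?s1(Suc k := f c))" "exec_le Q ?s1 (poly q ?z) (?s1(Suc k := g c))"
        using P Q layout_extend[OF lay vs(2)] by (auto simp: implements_def)
      then have "exec_le ?I ?s1 (Suc (poly p ?z + poly q ?z)) ?s2"
        by (intro exec_le_If) (auto elim: exec_le_mono)
      then have 2: "exec_le ?I ?s1 (poly (p + q + 1) ?z) ?s2" by simp
      have "exec_le ?M ?s2 (2 * length (?s2 k) + 8 * length (?s2 (Suc k)) + 3) ?s3"
        by (rule exec_le_replace) (use lay in \<open>auto simp: layout_def\<close>)
      then have 3: "exec_le ?M ?s2 (poly (2 * n + 8 * (l + m) + 3) ?z) ?s3"
        by (rule exec_le_mono) (use l[of c] m[of c] n[of c] in simp)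
      have "?s3 = s(k := ?h c)" using lay by (auto simp: fun_eq_iff layout_def)
      then show ?thesis using exec_le_Seq[OF 1 exec_le_Seq[OF 2 3]] by (simp only: poly_add)
    qed
    ultimately show "\<exists>P. implements \<Gamma> ?h ?r k vs P" unfolding implements_def by blast
  qed
qed

text \<open>The same program works after a substitution if its arguments are read from other stacks.
  Several entries may use one stack, hence the factor \<open>length \<Gamma>\<close> in the
  size.\<close>

lemma pt_reindex:
  assumes "pt \<Gamma> f" "\<And>g. g \<in> set \<Gamma> \<Longrightarrow> (\<lambda>x. g (h x)) \<in> set \<Gamma>'"
  shows "pt \<Gamma>' (\<lambda>x. f (h x))"
proof -
  obtain p where p: "\<And>k vs. length vs = length \<Gamma> \<Longrightarrow> set vs \<subseteq> {..<k} \<Longrightarrow> \<exists>P. implements \<Gamma> f p k vs P"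
    using ptE[OF assms(1)] by blast
  have "\<forall>j<length \<Gamma>. \<exists>i<length \<Gamma>'. \<Gamma>' ! i = (\<lambda>x. (\<Gamma> ! j) (h x))"
    using assms(2) by (metis in_set_conv_nth nth_mem)
  then obtain w where w: "\<And>j. j < length \<Gamma> \<Longrightarrow> w j < length \<Gamma>'"
      "\<And>j. j < length \<Gamma> \<Longrightarrow> \<Gamma>' ! w j = (\<lambda>x. (\<Gamma> ! j) (h x))" by metis
  let ?r = "pcompose p [:0, length \<Gamma>:]"
  have z: "ctx_size \<Gamma> (h x) \<le> length \<Gamma> * ctx_size \<Gamma>' x" for x
  proof -
    have "ctx_size \<Gamma> (h x) \<le> (\<Sum>g\<leftarrow>\<Gamma>. ctx_size \<Gamma>' x)"
      unfolding ctx_size_def[of \<Gamma>]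
      by (rule sum_list_mono) (use assms(2) length_le_ctx_size in fastforce)
    then show ?thesis by (simp add: sum_list_triv)
  qed
  show ?thesis
  proof (rule ptI)
    fix k and vs :: "nat list"
    assume vs: "length vs = length \<Gamma>'" "set vs \<subseteq> {..<k}"
    let ?vs = "map (\<lambda>j. vs ! w j) [0..<length \<Gamma>]"
    have "set ?vs \<subseteq> {..<k}" using vs w(1) by (auto dest!: subsetD)
    then obtain P where P: "implements \<Gamma> f p k ?vs P" using p[of ?vs k] by force
    have "exec_le P s (poly ?r (ctx_size \<Gamma>' x)) (s(k := f (h x)))" if lay: "layout \<Gamma>' x vs k s" for x s
    proof -
      have "s (vs ! w j) = (\<Gamma> ! j) (h x)" if "j < length \<Gamma>" for j
        using lay w(1)[OF that] w(2)[OF that] vs(1) unfolding layout_def by (metis nth_map)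
      then have "layout \<Gamma> (h x) ?vs k s"
        using lay by (auto simp: layout_def intro!: nth_equalityI)
      then have "exec_le P s (poly p (ctx_size \<Gamma> (h x))) (s(k := f (h x)))"
        using P by (auto simp: implements_def)
      then show ?thesis
        by (rule exec_le_mono) (use poly_nat_mono[OF z, of p] in \<open>simp add: poly_pcompose mult.commute\<close>)
    qed
    then have "implements \<Gamma>' (\<lambda>x. f (h x)) ?r k vs P"
      using P unfolding implements_def by blast
    then show "\<exists>P. implements \<Gamma>' (\<lambda>x. f (h x)) ?r k vs P" by blast
  qed
qed

definition loop_ctx :: "('c \<Rightarrow> nat list) list \<Rightarrow> ('c \<times> nat \<Rightarrow> nat list) list" where
  "loop_ctx \<Gamma> = map (\<lambda>g x. g (fst x)) \<Gamma> @ [\<lambda>x. replicate (snd x) 1]"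

text \<open>
  \<open>F c i\<close> is the accumulator after \<open>i\<close> rounds. The bound on its length is essential: the step
  function alone could double it in every round.
\<close>

lemma pt_iter:
  fixes F :: "'c \<Rightarrow> nat \<Rightarrow> nat list"
  assumes "pt \<Gamma> xs" "pt \<Gamma> (\<lambda>c. F c 0)"
    and "pt (loop_ctx \<Gamma> @ [\<lambda>x. F (fst x) (snd x)]) (\<lambda>x. F (fst x) (Suc (snd x)))"
    and "\<And>c i. i \<le> length (xs c) \<Longrightarrow> length (F c i) \<le> poly l (ctx_size \<Gamma> c)"
  shows "pt \<Gamma> (\<lambda>c. F c (length (xs c)))"
proof -
  let ?\<Gamma> = "loop_ctx \<Gamma> @ [\<lambda>x. F (fst x) (snd x)]"
  obtain p where p: "\<And>k vs. length vs = length \<Gamma> \<Longrightarrow> set vs \<subseteq> {..<k} \<Longrightarrow> \<exists>P. implements \<Gamma> xs p k vs P"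
    using ptE[OF assms(1)] by blast
  obtain q where q: "\<And>k vs. length vs = length \<Gamma> \<Longrightarrow> set vs \<subseteq> {..<k} \<Longrightarrow> \<exists>P. implements \<Gamma> (\<lambda>c. F c 0) q k vs P"
    using ptE[OF assms(2)] by blast
  obtain r where r: "\<And>k vs. length vs = length ?\<Gamma> \<Longrightarrow> set vs \<subseteq> {..<k} \<Longrightarrow>
      \<exists>P. implements ?\<Gamma> (\<lambda>x. F (fst x) (Suc (snd x))) r k vs P"
    using ptE[OF assms(3)] by blast
  obtain n where n: "\<And>c. length (xs c) \<le> poly n (ctx_size \<Gamma> c)" using pt_length[OF assms(1)] by blast
  \<comment> \<open>Cost of one round: the body sees the context, a counter of length at most
    \<open>n\<close> and an accumulator of length at most \<open>l\<close>; then the accumulator is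
    replaced, followed by one push and one pop.\<close>
  let ?b = "pcompose r ([:0, 1:] + n + l) + (2 * l + 8 * l + 3) + 3"
  let ?t = "q + (p + ((1 + n * (1 + ?b)) + (2 * n + 1)))"
  show ?thesis
  proof (rule ptI)
    fix k and vs :: "nat list"
    assume vs: "length vs = length \<Gamma>" "set vs \<subseteq> {..<k}"
    obtain Q where Q: "implements \<Gamma> (\<lambda>c. F c 0) q k vs Q" using q vs by blast
    have "set vs \<subseteq> {..<k + 2}" using vs by auto
    then obtain P where P: "implements \<Gamma> xs p (k + 2) vs P" using p[of vs "k + 2"] vs by auto
    have "length (vs @ [k + 1, k]) = length ?\<Gamma>" "set (vs @ [k + 1, k]) \<subseteq> {..<k + 3}"
      using vs by (auto simp: loop_ctx_def)
    then obtain R where R: "implements ?\<Gamma> (\<lambda>x. F (fst x) (Suc (snd x))) r (k + 3) (vs @ [k + 1, k]) R"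
      using r by blast
    let ?B = "Seq R (Seq (replace k (k + 3) (k + 4)) (Seq (Push (k + 1) 1) (Pop (k + 2))))"
    let ?L = "Seq (While (k + 2) ?B) (clear (k + 1))"
    let ?T = "Seq Q (Seq P ?L)"
    obtain K1 where "wf_prog K1 nsym R" "wf_prog K1 nsym P" "K1 \<ge> k + 5"
      using R P wf_prog_common[of _ nsym R _ P "k + 5"] unfolding implements_def by metis
    then have "wf_prog K1 nsym (Seq P ?L)" by (simp add: nsym_def)
    then obtain K where "wf_prog K nsym (Seq P ?L)" "wf_prog K nsym Q"
      using Q wf_prog_common[of _ nsym Q _ "Seq P ?L" 0] unfolding implements_def by metis
    then have "wf_prog K nsym ?T" by simp
    moreover have "exec_le ?T s (poly ?t (ctx_size \<Gamma> c)) (s(k := F c (length (xs c))))"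
      if lay: "layout \<Gamma> c vs k s" for c s
    proof -
      let ?z = "ctx_size \<Gamma> c"
      let ?N = "length (xs c)"
      let ?S = "\<lambda>i. s(k := F c i, k + 1 := replicate i 1, k + 2 := drop i (xs c))"
      have se: "\<And>v. v \<ge> k \<Longrightarrow> s v = []" and sv: "map s vs = map (\<lambda>g. g c) \<Gamma>"
        using lay by (auto simp: layout_def)
      have 1: "exec_le Q s (poly q ?z) (s(k := F c 0))"
        using Q lay by (auto simp: implements_def)
      have "layout \<Gamma> c vs (k + 2) (s(k := F c 0))"
        using layout_extend[OF lay vs(2)] by (auto simp: layout_def)
      then have "exec_le P (s(k := F c 0)) (poly p ?z) (s(k := F c 0, k + 2 := xs c))"
        using P by (auto simp: implements_def)
      moreover have "s(k := F c 0, k + 2 := xs c) = ?S 0" using se by (auto simp: fun_eq_iff)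
      ultimately have 2: "exec_le P (s(k := F c 0)) (poly p ?z) (?S 0)" by simp
      have body: "exec_le ?B (?S i) (poly ?b ?z) (?S (Suc i))" if i: "i < ?N" for i
      proof -
        let ?y = "F c (Suc i)"
        have Fl: "length (F c i) \<le> poly l ?z" "length ?y \<le> poly l ?z"
          using assms(4)[of i c] assms(4)[of "Suc i" c] i by simp_all
        have "?S i v = s v" if "v \<in> set vs" for v
        proof -
          have "v < k" using that vs(2) by auto
          then show ?thesis by simp
        qed
        then have "map (?S i) vs = map (\<lambda>g. g c) \<Gamma>" using sv by (simp cong: map_cong)
        then have "layout ?\<Gamma> (c, i) (vs @ [k + 1, k]) (k + 3) (?S i)"
          using se by (simp add: layout_def loop_ctx_def comp_def)
        then have "exec_le R (?S i) (poly r (ctx_size ?\<Gamma> (c, i))) ((?S i)(k + 3 := ?y))"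
          using R by (auto simp: implements_def)
        moreover have "ctx_size ?\<Gamma> (c, i) \<le> poly ([:0, 1:] + n + l) ?z"
          using Fl(1) i n[of c] by (simp add: ctx_size_def loop_ctx_def comp_def)
        ultimately have b1: "exec_le R (?S i) (poly (pcompose r ([:0, 1:] + n + l)) ?z) ((?S i)(k + 3 := ?y))"
          unfolding poly_pcompose by (blast intro: exec_le_mono poly_nat_mono)
        let ?s1 = "(?S i)(k + 3 := ?y)"
        let ?s2 = "?s1(k := ?s1 (k + 3), k + 3 := [])"
        have "exec_le (replace k (k + 3) (k + 4)) ?s1
            (2 * length (?s1 k) + 8 * length (?s1 (k + 3)) + 3) ?s2"
          by (rule exec_le_replace) (use se in auto)
        then have b2: "exec_le (replace k (k + 3) (k + 4)) ?s1 (poly (2 * l + 8 * l + 3) ?z) ?s2"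
          by (rule exec_le_mono) (use Fl in simp)
        let ?s3 = "?s2(k + 1 := 1 # ?s2 (k + 1))"
        let ?s4 = "?s3(k + 2 := tl (?s3 (k + 2)))"
        have b3: "exec_le (Seq (Push (k + 1) 1) (Pop (k + 2))) ?s2 (2 + 1) ?s4"
          by (rule exec_le_Seq[OF exec_le_Push exec_le_Pop])
        have "?s4 = ?S (Suc i)"
          using se by (auto simp: fun_eq_iff drop_Suc tl_drop)
        then have "exec_le ?B (?S i) (poly (pcompose r ([:0, 1:] + n + l)) ?z + 
            (poly (2 * l + 8 * l + 3) ?z + (2 + 1))) (?S (Suc i))"
          using exec_le_Seq[OF b1 exec_le_Seq[OF b2 b3]] by metis
        then show ?thesis by (simp add: algebra_simps)
      qed
      have "exec_le (While (k + 2) ?B) (?S 0) (Suc (?N * Suc (poly ?b ?z))) (?S ?N)"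
        by (rule exec_le_While[where S = ?S, OF _ _ body]) auto
      then have 3: "exec_le (While (k + 2) ?B) (?S 0) (poly (1 + n * (1 + ?b)) ?z) (?S ?N)"
        by (rule exec_le_mono) (use mult_le_mono1[OF n, of c "Suc (poly ?b ?z)"] in simp)
      have "exec_le (clear (k + 1)) (?S ?N) (2 * length (?S ?N (k + 1)) + 1) ((?S ?N)(k + 1 := []))"
        by (rule exec_le_clear)
      then have 4: "exec_le (clear (k + 1)) (?S ?N) (poly (2 * n + 1) ?z) ((?S ?N)(k + 1 := []))"
        by (rule exec_le_mono) (use n[of c] in simp)
      have "(?S ?N)(k + 1 := []) = s(k := F c ?N)" using se by (auto simp: fun_eq_iff)
      then show ?thesis
        using exec_le_Seq[OF 1 exec_le_Seq[OF 2 exec_le_Seq[OF 3 4]]] by (simp only: poly_add)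
    qed
    ultimately show "\<exists>P. implements \<Gamma> (\<lambda>c. F c (length (xs c))) ?t k vs P"
      unfolding implements_def by blast
  qed
qed

theorem pt_polytime_computable:
  assumes "pt [\<lambda>x. x] h" "\<And>x. x \<in> I \<Longrightarrow> h (enc_in x) = enc_out (f x)"
    and "\<And>x. x \<in> I \<Longrightarrow> set (enc_in x) \<subseteq> {1..<nsym}"
  shows "polytime_computable I enc_in enc_out f"
proof -
  obtain p where p: "\<And>k vs. length vs = 1 \<Longrightarrow> set vs \<subseteq> {..<k} \<Longrightarrow>
      \<exists>P. implements [\<lambda>x. x] h p k vs P"
    using ptE[OF assms(1)] by (metis One_nat_def length_Cons list.size(3))
  obtain P where P: "implements [\<lambda>x. x] h p 1 [0] P" using p[of "[0]" 1] by auto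
  obtain l where l: "\<And>c. length (h c) \<le> poly l (ctx_size [\<lambda>x. x] c)" using pt_length[OF assms(1)] by blast
  \<comment> \<open>The output is read from tape \<open>0\<close>, so the result is moved
    there.\<close>
  let ?Q = "Seq P (replace 0 1 2)"
  obtain K where K: "wf_prog K nsym P" "wf_prog K nsym P" "K \<ge> 3"
    using P wf_prog_common[of _ nsym P _ P 3] unfolding implements_def by metis
  let ?r = "p + ([:0, 2:] + 8 * l + 3)"
  have "tm_computes_within (prog_tm K nsym ?Q) (enc_in x) (enc_out (f x)) (poly ?r (length (enc_in x)))"
    if x: "x \<in> I" for x
  proof -
    let ?c = "enc_in x"
    let ?s = "(\<lambda>_ :: nat. [])(0 := ?c)"
    let ?s1 = "?s(1 := h ?c)"
    let ?s2 = "?s1(0 := ?s1 1, 1 := [])"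
    have z: "ctx_size [\<lambda>x. x] ?c = length ?c" by (simp add: ctx_size_def)
    have "layout [\<lambda>x. x] ?c [0] 1 ?s" by (simp add: layout_def)
    then have 1: "exec_le P ?s (poly p (length ?c)) ?s1"
      using P unfolding implements_def z[symmetric] by blast
    have "exec_le (replace 0 1 2) ?s1 (2 * length (?s1 0) + 8 * length (?s1 1) + 3) ?s2"
      by (rule exec_le_replace) auto
    then have "exec_le (replace 0 1 2) ?s1 (poly ([:0, 2:] + 8 * l + 3) (length ?c)) ?s2"
      by (rule exec_le_mono) (use l[of ?c] z in simp)
    from exec_le_Seq[OF 1 this] obtain t where "t \<le> poly ?r (length ?c)" "exec ?Q ?s t ?s2"
      by (auto simp: exec_le_def)
    from prog_tm_computes[OF this(2) _ _ assms(3)[OF x] this(1), of K] K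
    show ?thesis using assms(2)[OF x] by simp
  qed
  moreover have "wf_tm (prog_tm K nsym ?Q)" by (rule wf_prog_tm) (use K in \<open>auto simp: nsym_def\<close>)
  ultimately show ?thesis unfolding polytime_computable_def by blast
qed

section \<open>Unary and binary arithmetic\<close>

lemma pt_weaken: "pt \<Gamma> f \<Longrightarrow> set \<Gamma> \<subseteq> set \<Gamma>' \<Longrightarrow> pt \<Gamma>' f"
  using pt_reindex[of \<Gamma> f "\<lambda>x. x" \<Gamma>'] by auto

lemma pt_snoc: "pt \<Gamma> f \<Longrightarrow> pt (\<Gamma> @ [g]) f"
  by (erule pt_weaken) auto

lemma pt_lift: "pt \<Gamma> f \<Longrightarrow> pt (loop_ctx \<Gamma>) (\<lambda>x. f (fst x))"
  by (erule pt_reindex) (auto simp: loop_ctx_def)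

text \<open>Unary numbers make arithmetic a matter of list lengths. They suffice for everything
  polynomial in the input, such as primes, numbers of blockers and even blocker periods.\<close>

definition pu :: "('c \<Rightarrow> nat list) list \<Rightarrow> ('c \<Rightarrow> nat) \<Rightarrow> bool" where
  "pu \<Gamma> n \<longleftrightarrow> pt \<Gamma> (\<lambda>c. replicate (n c) 1)"

definition pb :: "('c \<Rightarrow> nat list) list \<Rightarrow> ('c \<Rightarrow> bool) \<Rightarrow> bool" where
  "pb \<Gamma> P \<longleftrightarrow> pt \<Gamma> (\<lambda>c. if P c then [1] else [])"

lemma pu_snoc: "pu \<Gamma> n \<Longrightarrow> pu (\<Gamma> @ [g]) n"
  unfolding pu_def by (rule pt_snoc)

lemma pb_snoc: "pb \<Gamma> P \<Longrightarrow> pb (\<Gamma> @ [g]) P"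
  unfolding pb_def by (rule pt_snoc)

lemma pu_lift: "pu \<Gamma> n \<Longrightarrow> pu (loop_ctx \<Gamma>) (\<lambda>x. n (fst x))"
  unfolding pu_def by (rule pt_lift)

lemma pu_index: "pu (loop_ctx \<Gamma>) snd"
  unfolding pu_def by (rule pt_var) (simp add: loop_ctx_def)

lemma pu_bound: "pu \<Gamma> n \<Longrightarrow> \<exists>p. \<forall>c. n c \<le> poly p (ctx_size \<Gamma> c)"
  unfolding pu_def by (drule pt_length) simp

lemma pt_if:
  assumes "pb \<Gamma> P" "pt \<Gamma> f" "pt \<Gamma> g"
  shows "pt \<Gamma> (\<lambda>c. if P c then f c else g c)"
proof -
  have "(top0 (if P c then [1] else []) = 1) = P c" for c by (simp add: top0_def)
  then show ?thesis using pt_if_top[OF assms[unfolded pb_def], of 1] by simp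
qed

lemma pb_top:
  assumes "pt \<Gamma> f"
  shows "pb \<Gamma> (\<lambda>c. top0 (f c) = a)"
  unfolding pb_def using assms
  by (intro pt_if_top pt_Cons pt_nil) (auto simp: nsym_def)

lemma pb_True: "pb \<Gamma> (\<lambda>_. True)"
  unfolding pb_def by (auto intro!: pt_Cons pt_nil simp: nsym_def)

lemma pb_if:
  assumes "pb \<Gamma> P" "pb \<Gamma> Q" "pb \<Gamma> R"
  shows "pb \<Gamma> (\<lambda>c. if P c then Q c else R c)"
proof -
  have "(if if P c then Q c else R c then [1] else []) =
      (if P c then if Q c then [1] else [] else if R c then [1::nat] else [])" for c by simp
  then show ?thesis
    using pt_if[OF assms(1) assms(2,3)[unfolded pb_def]] unfolding pb_def by presburger
qed

lemma pb_False: "pb \<Gamma> (\<lambda>_. False)"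
  unfolding pb_def by (simp add: pt_nil)

lemma pb_not:
  assumes "pb \<Gamma> P"
  shows "pb \<Gamma> (\<lambda>c. \<not> P c)"
proof -
  have "(\<not> P c) = (if P c then False else True)" for c by simp
  then show ?thesis using pb_if[OF assms pb_False pb_True] by presburger
qed

lemma pb_and:
  assumes "pb \<Gamma> P" "pb \<Gamma> Q"
  shows "pb \<Gamma> (\<lambda>c. P c \<and> Q c)"
proof -
  have "(P c \<and> Q c) = (if P c then Q c else False)" for c by simp
  then show ?thesis using pb_if[OF assms pb_False] by presburger
qed

lemma pb_or: "pb \<Gamma> P \<Longrightarrow> pb \<Gamma> Q \<Longrightarrow> pb \<Gamma> (\<lambda>c. P c \<or> Q c)"
  using pb_not[OF pb_and[OF pb_not pb_not]] by simp

lemma pu_const: "pu \<Gamma> (\<lambda>_. n)"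
  unfolding pu_def by (induction n) (auto intro!: pt_nil pt_Cons simp: nsym_def)

lemma pu_add: "pu \<Gamma> m \<Longrightarrow> pu \<Gamma> n \<Longrightarrow> pu \<Gamma> (\<lambda>c. m c + n c)"
  unfolding pu_def by (simp add: replicate_add pt_append)

lemma pu_Suc: "pu \<Gamma> n \<Longrightarrow> pu \<Gamma> (\<lambda>c. Suc (n c))"
  using pu_add[OF pu_const[of \<Gamma> 1]] by simp

lemma pu_if: "pb \<Gamma> P \<Longrightarrow> pu \<Gamma> m \<Longrightarrow> pu \<Gamma> n \<Longrightarrow> pu \<Gamma> (\<lambda>c. if P c then m c else n c)"
  unfolding pu_def by (simp add: pt_if if_distrib[of "\<lambda>n. replicate n _"])

lemma pu_length:
  assumes "pt \<Gamma> xs"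
  shows "pu \<Gamma> (\<lambda>c. length (xs c))"
proof -
  obtain p where p: "\<And>c. length (xs c) \<le> poly p (ctx_size \<Gamma> c)" using pt_length[OF assms] by blast
  show ?thesis unfolding pu_def
  proof (rule pt_iter[OF assms, where F = "\<lambda>_ i. replicate i 1" and l = p])
    show "pt \<Gamma> (\<lambda>c. replicate 0 1)" by (simp add: pt_nil)
    show "pt (loop_ctx \<Gamma> @ [\<lambda>x. replicate (snd x) 1]) (\<lambda>x. replicate (Suc (snd x)) 1)"
      using pu_snoc[OF pu_Suc[OF pu_index]] unfolding pu_def .
  qed (use p order_trans in \<open>simp; blast\<close>)
qed

lemma pt_concat:
  assumes "pu \<Gamma> n" "pt (loop_ctx \<Gamma>) (\<lambda>x. g (fst x) (snd x))"
  shows "pt \<Gamma> (\<lambda>c. concat (map (g c) [0..<n c]))"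
proof -
  obtain p where p: "\<And>c. n c \<le> poly p (ctx_size \<Gamma> c)" using pu_bound[OF assms(1)] by blast
  obtain q where q: "\<And>x. length (g (fst x) (snd x)) \<le> poly q (ctx_size (loop_ctx \<Gamma>) x)"
    using pt_length[OF assms(2)] by blast
  let ?F = "\<lambda>c i. concat (map (g c) [0..<i])"
  let ?l = "p * pcompose q ([:0, 1:] + p)"
  have "pt \<Gamma> (\<lambda>c. ?F c (length (replicate (n c) (1::nat))))"
  proof (rule pt_iter[OF assms(1)[unfolded pu_def], where F = ?F and l = ?l])
    show "pt \<Gamma> (\<lambda>c. concat (map (g c) [0..<0]))" by (simp add: pt_nil)
    have "pt (loop_ctx \<Gamma> @ [\<lambda>x. ?F (fst x) (snd x)])
        (\<lambda>x. ?F (fst x) (snd x) @ g (fst x) (snd x))"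
      by (intro pt_append pt_var pt_snoc[OF assms(2)]) simp
    then show "pt (loop_ctx \<Gamma> @ [\<lambda>x. ?F (fst x) (snd x)]) (\<lambda>x. ?F (fst x) (Suc (snd x)))"
      by simp
  next
    fix c i assume "i \<le> length (replicate (n c) (1::nat))"
    then have i: "i \<le> n c" by simp
    have le: "length (g c j) \<le> poly q (ctx_size \<Gamma> c + n c)" if "j < n c" for j
    proof -
      have "ctx_size (loop_ctx \<Gamma>) (c, j) \<le> ctx_size \<Gamma> c + n c"
        using that by (simp add: ctx_size_def loop_ctx_def comp_def)
      then show ?thesis using order_trans[OF q[of "(c, j)", simplified] poly_nat_mono] by blast
    qed
    have "length (?F c i) = (\<Sum>j\<leftarrow>[0..<i]. length (g c j))"
      by (simp add: length_concat comp_def)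
    also have "\<dots> \<le> (\<Sum>j\<leftarrow>[0..<i]. poly q (ctx_size \<Gamma> c + n c))"
      by (rule sum_list_mono) (use i le in auto)
    also have "\<dots> = i * poly q (ctx_size \<Gamma> c + n c)" by (simp add: sum_list_triv)
    also have "\<dots> \<le> poly p (ctx_size \<Gamma> c) * poly q (ctx_size \<Gamma> c + poly p (ctx_size \<Gamma> c))"
      by (intro mult_mono poly_nat_mono) (use i p[of c] in auto)
    finally show "length (?F c i) \<le> poly ?l (ctx_size \<Gamma> c)" by (simp add: poly_pcompose)
  qed
  then show ?thesis by simp
qed

lemma concat_map_replicate: "concat (map (\<lambda>i. replicate (f i) a) [0..<n]) = replicate (\<Sum>i<n. f i) a"
  by (induction n) (auto simp: replicate_add)

lemma pu_sum:
  assumes "pu \<Gamma> n" "pu (loop_ctx \<Gamma>) (\<lambda>x. f (fst x) (snd x))"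
  shows "pu \<Gamma> (\<lambda>c. \<Sum>i<n c. f c i)"
  using pt_concat[OF assms(1), of "\<lambda>c i. replicate (f c i) 1"] assms(2)
  by (simp add: pu_def concat_map_replicate)

lemma pu_mult: "pu \<Gamma> m \<Longrightarrow> pu \<Gamma> n \<Longrightarrow> pu \<Gamma> (\<lambda>c. m c * n c)"
  using pu_sum[of \<Gamma> m "\<lambda>c _. n c"] pu_lift[of \<Gamma> n] by simp

lemma pt_drop:
  assumes "pt \<Gamma> xs" "pu \<Gamma> n"
  shows "pt \<Gamma> (\<lambda>c. drop (n c) (xs c))"
proof -
  obtain p where p: "\<And>c. length (xs c) \<le> poly p (ctx_size \<Gamma> c)" using pt_length[OF assms(1)] by blast
  let ?F = "\<lambda>c i. drop i (xs c)"
  have "pt \<Gamma> (\<lambda>c. ?F c (length (replicate (n c) (1::nat))))"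
  proof (rule pt_iter[OF assms(2)[unfolded pu_def], where F = ?F and l = p])
    have "pt (loop_ctx \<Gamma> @ [\<lambda>x. ?F (fst x) (snd x)]) (\<lambda>x. tl (?F (fst x) (snd x)))"
      by (intro pt_tl pt_var) simp
    then show "pt (loop_ctx \<Gamma> @ [\<lambda>x. ?F (fst x) (snd x)]) (\<lambda>x. ?F (fst x) (Suc (snd x)))"
      by (simp add: drop_Suc tl_drop)
  next
    show "length (?F c i) \<le> poly p (ctx_size \<Gamma> c)" for c i
      using p[of c] by simp
  qed (use assms(1) in simp)
  then show ?thesis by simp
qed

lemma pu_diff:
  assumes "pu \<Gamma> m" "pu \<Gamma> n"
  shows "pu \<Gamma> (\<lambda>c. m c - n c)"
  using pt_drop[OF assms(1)[unfolded pu_def] assms(2)] by (simp add: pu_def)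

lemma pb_less:
  assumes "pu \<Gamma> m" "pu \<Gamma> n"
  shows "pb \<Gamma> (\<lambda>c. m c < n c)"
proof -
  have "(top0 (replicate (n c - m c) 1) = 1) = (m c < n c)" for c
    by (auto simp: top0_def)
  then show ?thesis using pb_top[OF pu_diff[OF assms(2,1), unfolded pu_def], of 1] by simp
qed

lemma pb_le: "pu \<Gamma> m \<Longrightarrow> pu \<Gamma> n \<Longrightarrow> pb \<Gamma> (\<lambda>c. m c \<le> n c)"
  using pb_not[OF pb_less[of \<Gamma> n m]] by (simp add: not_less)

lemma pb_eq: "pu \<Gamma> m \<Longrightarrow> pu \<Gamma> n \<Longrightarrow> pb \<Gamma> (\<lambda>c. m c = n c)"
  using pb_and[OF pb_le[of \<Gamma> m n] pb_le[of \<Gamma> n m]] by (simp add: eq_iff)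

lemma pu_card:
  assumes "pu \<Gamma> n" "pb (loop_ctx \<Gamma>) (\<lambda>x. P (fst x) (snd x))"
  shows "pu \<Gamma> (\<lambda>c. card {i. i < n c \<and> P c i})"
proof -
  have "card {i. i < n c \<and> P c i} = (\<Sum>i<n c. if P c i then 1 else 0)" for c
    by (simp add: sum.If_cases Int_def)
  then show ?thesis
    using pu_sum[OF assms(1) pu_if[OF assms(2) pu_const[of _ 1] pu_const[of _ 0]]] by simp
qed

lemma pb_ex:
  assumes "pu \<Gamma> n" "pb (loop_ctx \<Gamma>) (\<lambda>x. P (fst x) (snd x))"
  shows "pb \<Gamma> (\<lambda>c. \<exists>i<n c. P c i)"
proof -
  have "(0 < card {i. i < n c \<and> P c i}) = (\<exists>i<n c. P c i)" for c
    by (auto simp: card_gt_0_iff)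
  then show ?thesis using pb_less[OF pu_const pu_card[OF assms], of 0] by simp
qed

text \<open>Only bounded quantifiers and a product occur, the form that \<open>pb_ex\<close> and
  \<open>pu_mult\<close> can handle.\<close>

lemma prime_iff_no_product:
  "prime m \<longleftrightarrow> 1 < m \<and> \<not> (\<exists>i<m. \<exists>j<m. i * j = m)" for m :: nat
proof (cases "1 < m")
  case True
  show ?thesis
  proof
    assume p: "prime m"
    have False if "i < m" "j < m" "i * j = m" for i j
    proof -
      have "m dvd i \<or> m dvd j" using prime_dvd_multD[OF p] that(3) by simp
      then show False using that True by (auto dest!: dvd_imp_le)
    qed
    then show "1 < m \<and> \<not> (\<exists>i<m. \<exists>j<m. i * j = m)" using True by blast
  next
    assume r: "1 < m \<and> \<not> (\<exists>i<m. \<exists>j<m. i * j = m)"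
    have "d = 1 \<or> d = m" if "d dvd m" for d
    proof (rule ccontr)
      assume n: "\<not> (d = 1 \<or> d = m)"
      obtain k where k: "m = d * k" using \<open>d dvd m\<close> by blast
      have "d \<noteq> 0" "k \<noteq> 0" using k True by (metis mult_is_0 not_less_zero)+
      moreover have "k \<noteq> 1" using k n by auto
      ultimately have "d < m" "k < m" using k n by auto
      then show False using r k by blast
    qed
    then show "prime m" using True by (simp add: prime_nat_iff)
  qed
next
  case False
  then show ?thesis using prime_gt_1_nat by blast
qed

lemma pb_prime:
  assumes "pu \<Gamma> m"
  shows "pb \<Gamma> (\<lambda>c. prime (m c))"
  unfolding prime_iff_no_product
  by (intro pb_and pb_less pu_const assms pb_not pb_ex pb_eq pu_mult pu_lift pu_index)

lemma pu_div2:
  assumes "pu \<Gamma> m"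
  shows "pu \<Gamma> (\<lambda>c. m c div 2)"
proof -
  have "{i. i < m c \<and> Suc (i + i) < m c} = {..<m c div 2}" for c by auto
  then have "card {i. i < m c \<and> Suc (i + i) < m c} = m c div 2" for c by simp
  moreover have "pu \<Gamma> (\<lambda>c. card {i. i < m c \<and> Suc (i + i) < m c})"
    by (intro pu_card pb_less pu_Suc pu_add pu_index pu_lift assms)
  ultimately show ?thesis by simp
qed

lemma pb_odd:
  assumes "pu \<Gamma> m"
  shows "pb \<Gamma> (\<lambda>c. odd (m c))"
proof -
  have "odd (m c) = (m c div 2 + m c div 2 < m c)" for c by presburger
  moreover have "pb \<Gamma> (\<lambda>c. m c div 2 + m c div 2 < m c)"
    by (intro pb_less pu_add pu_div2 assms)
  ultimately show ?thesis by simp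
qed

lemma pu_iter:
  assumes "pu \<Gamma> n" "pu \<Gamma> (\<lambda>c. F c 0)"
    and "pu (loop_ctx \<Gamma> @ [\<lambda>x. replicate (F (fst x) (snd x)) 1]) (\<lambda>x. F (fst x) (Suc (snd x)))"
    and "\<And>c i. i \<le> n c \<Longrightarrow> F c i \<le> b c" "pu \<Gamma> b"
  shows "pu \<Gamma> (\<lambda>c. F c (n c))"
proof -
  obtain p where p: "\<And>c. b c \<le> poly p (ctx_size \<Gamma> c)" using pu_bound[OF assms(5)] by blast
  have "pt \<Gamma> (\<lambda>c. replicate (F c (length (replicate (n c) (1::nat)))) 1)"
  proof (rule pt_iter[OF assms(1)[unfolded pu_def], where l = p])
    show "length (replicate (F c i) (1::nat)) \<le> poly p (ctx_size \<Gamma> c)"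
      if "i \<le> length (replicate (n c) (1::nat))" for c i
      using that assms(4)[of i c] p[of c] by simp
  qed (use assms(2,3) in \<open>simp_all add: pu_def\<close>)
  then show ?thesis by (simp add: pu_def)
qed

section \<open>Multiplication of a binary number by a unary one\<close>

lemma enc_nat_0 [simp]: "enc_nat 0 = []"
  by (simp add: enc_nat.simps)

lemma drop_enc_nat: "drop i (enc_nat m) = enc_nat (m div 2 ^ i)"
proof (induction i arbitrary: m)
  case (Suc i)
  have "drop (Suc i) (enc_nat m) = drop i (enc_nat (m div 2))"
    by (cases "m = 0") (simp_all add: enc_nat.simps[of m])
  then show ?case using Suc by (simp add: div_mult2_eq)
qed simp

lemma enc_nat_Nil_iff: "enc_nat m = [] \<longleftrightarrow> m = 0"
  by (simp add: enc_nat.simps[of m])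

lemma length_enc_nat_le_iff: "length (enc_nat m) \<le> k \<longleftrightarrow> m < 2 ^ k"
proof -
  have "length (enc_nat m) \<le> k \<longleftrightarrow> drop k (enc_nat m) = []" by simp
  then show ?thesis by (simp only: drop_enc_nat enc_nat_Nil_iff) (simp add: div_eq_0_iff)
qed

lemma top0_drop_enc_nat: "top0 (drop i (enc_nat m)) = 2 \<longleftrightarrow> odd (m div 2 ^ i)"
  unfolding drop_enc_nat by (auto simp: top0_def enc_nat.simps[of "m div 2 ^ i"] enc_bit_def)

lemma enc_nat_conv:
  "length (enc_nat m) \<le> k \<Longrightarrow>
   enc_nat m = concat (map (\<lambda>i. if m div 2 ^ i > 0 then [if odd (m div 2 ^ i) then 2 else 1] else []) [0..<k])"
proof (induction k arbitrary: m)
  case (Suc k)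
  have 1: "[0..<Suc k] = 0 # map Suc [0..<k]" by (simp add: map_Suc_upt upt_conv_Cons del: upt_Suc)
  have 2: "m div 2 ^ Suc i = m div 2 div 2 ^ i" for i by (simp add: div_mult2_eq)
  show ?case
  proof (cases "m = 0")
    case False
    then have "length (enc_nat (m div 2)) \<le> k" using Suc.prems by (simp add: enc_nat.simps[of m])
    from Suc.IH[OF this] show ?thesis
      using False unfolding 1 list.map map_map comp_def 2
      by (simp add: enc_nat.simps[of m] enc_bit_def)
  qed simp
qed (simp add: enc_nat_Nil_iff)

lemma length_enc_nat_le: "length (enc_nat m) \<le> m"
  by (simp add: length_enc_nat_le_iff less_exp)

lemma length_enc_nat_mult: "length (enc_nat (m * n)) \<le> length (enc_nat m) + length (enc_nat n)"
proof -
  have "m < 2 ^ length (enc_nat m)" "n < 2 ^ length (enc_nat n)"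
    using length_enc_nat_le_iff by blast+
  then have "m * n < 2 ^ (length (enc_nat m) + length (enc_nat n))"
    unfolding power_add by (rule mult_strict_mono) auto
  then show ?thesis by (simp add: length_enc_nat_le_iff)
qed

text \<open>
  The carry into digit \<open>i\<close> when \<open>m\<close> is multiplied by the small number \<open>q\<close> digit by digit.
\<close>

definition carry :: "nat \<Rightarrow> nat \<Rightarrow> nat \<Rightarrow> nat" where
  "carry m q i = q * (m mod 2 ^ i) div 2 ^ i"

lemma carry_le: "carry m q i \<le> q"
proof -
  have "q * (m mod 2 ^ i) \<le> q * 2 ^ i" by (simp add: less_imp_le)
  then have "carry m q i \<le> q * 2 ^ i div 2 ^ i" unfolding carry_def by (rule div_le_mono)
  then show ?thesis by simp
qed

lemma mult_div_power: "m * q div 2 ^ i = q * (m div 2 ^ i) + carry m q i"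
proof -
  have "m * q = q * (m mod 2 ^ i) + q * (m div 2 ^ i) * 2 ^ i"
    by (metis add.commute distrib_left div_mult_mod_eq mult.assoc mult.commute)
  then have "m * q div 2 ^ i = (q * (m mod 2 ^ i) + q * (m div 2 ^ i) * 2 ^ i) div 2 ^ i" by simp
  also have "\<dots> = q * (m div 2 ^ i) + carry m q i"
    unfolding carry_def by (subst div_mult_self1) simp_all
  finally show ?thesis .
qed

text \<open>Halving \<open>m * q div 2 ^ i\<close> gives the quotient for \<open>Suc i\<close>;
  expanding both by \<open>mult_div_power\<close>, the contributions of the higher digits of
  \<open>m\<close> cancel.\<close>

lemma carry_Suc: "carry m q (Suc i) = ((if odd (m div 2 ^ i) then q else 0) + carry m q i) div 2"
proof -
  have "q * (m div 2 ^ i div 2) + carry m q (Suc i) = m * q div 2 ^ i div 2"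
    using mult_div_power[of m q "Suc i"] by (simp add: div_mult2_eq mult.commute[of 2])
  also have "\<dots> = (q * (m div 2 ^ i) + carry m q i) div 2" by (simp add: mult_div_power)
  also have "q * (m div 2 ^ i) =
      (if odd (m div 2 ^ i) then q else 0) + 2 * (q * (m div 2 ^ i div 2))"
    by (auto elim!: oddE evenE simp: algebra_simps)
  finally show ?thesis by simp
qed

lemma pu_carry:
  assumes "pt \<Gamma> (\<lambda>c. enc_nat (m c))" "pu \<Gamma> q" "pu \<Gamma> n"
  shows "pu \<Gamma> (\<lambda>c. carry (m c) (q c) (n c))"
proof (rule pu_iter[OF assms(3) _ _ carry_le assms(2)])
  show "pu \<Gamma> (\<lambda>c. carry (m c) (q c) 0)" by (simp add: carry_def pu_const)
next
  let ?\<Gamma> = "loop_ctx \<Gamma> @ [\<lambda>x. replicate (carry (m (fst x)) (q (fst x)) (snd x)) 1]"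
  have 1: "pb ?\<Gamma> (\<lambda>x. odd (m (fst x) div 2 ^ snd x))"
    unfolding top0_drop_enc_nat[symmetric]
    by (intro pb_snoc pb_top pt_drop pt_lift[OF assms(1)] pu_index)
  have 2: "pu ?\<Gamma> (\<lambda>x. carry (m (fst x)) (q (fst x)) (snd x))"
    unfolding pu_def by (rule pt_var) simp
  show "pu ?\<Gamma> (\<lambda>x. carry (m (fst x)) (q (fst x)) (Suc (snd x)))"
    unfolding carry_Suc
    by (intro pu_div2 pu_add pu_if pu_const 1 2 pu_snoc[OF pu_lift[OF assms(2)]])
qed

lemma pt_mult:
  assumes "pt \<Gamma> (\<lambda>c. enc_nat (m c))" "pu \<Gamma> q"
  shows "pt \<Gamma> (\<lambda>c. enc_nat (m c * q c))"
proof -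
  let ?odd = "\<lambda>m q i. odd ((if odd (m div 2 ^ i) then q else 0) + carry m q i)"
  \<comment> \<open>The string of digit \<open>i\<close> of the product, empty beyond the leading
    digit: \<open>m * q div 2 ^ i\<close> is positive iff \<open>q\<close> is positive and
    \<open>m\<close> still has digits from \<open>i\<close> on, or there is a carry.\<close>
  let ?g = "\<lambda>c i. if (0 < q c \<and> i < length (enc_nat (m c))) \<or> 0 < carry (m c) (q c) i
                  then if ?odd (m c) (q c) i then [2 :: nat] else [1] else []"
  let ?L = "\<lambda>c. length (enc_nat (m c)) + q c"
  have eq: "enc_nat (m c * q c) = concat (map (?g c) [0..<?L c])" for c
  proof -
    have "length (enc_nat (m c * q c)) \<le> ?L c"
      using length_enc_nat_mult[of "m c" "q c"] length_enc_nat_le[of "q c"] by simp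
    then have 1: "enc_nat (m c * q c) = concat (map (\<lambda>i. if m c * q c div 2 ^ i > 0
        then [if odd (m c * q c div 2 ^ i) then 2 else 1 :: nat] else []) [0..<?L c])"
      by (rule enc_nat_conv)
    have "(if m c * q c div 2 ^ i > 0 then [if odd (m c * q c div 2 ^ i) then 2 else 1] else []) = ?g c i" for i
    proof -
      have "i < length (enc_nat (m c)) \<longleftrightarrow> m c div 2 ^ i > 0"
        using length_enc_nat_le_iff[of "m c" i] by (auto simp: not_le div_greater_zero_iff)
      then show ?thesis unfolding mult_div_power by auto
    qed
    then show ?thesis using 1 by presburger
  qed
  have "pt \<Gamma> (\<lambda>c. concat (map (?g c) [0..<?L c]))"
  proof (intro pt_concat pu_add pu_length assms)
    have 1: "pb (loop_ctx \<Gamma>) (\<lambda>x. odd (m (fst x) div 2 ^ snd x))"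
      unfolding top0_drop_enc_nat[symmetric]
      by (intro pb_top pt_drop pt_lift[OF assms(1)] pu_index)
    have 2: "pu (loop_ctx \<Gamma>) (\<lambda>x. carry (m (fst x)) (q (fst x)) (snd x))"
      by (intro pu_carry pt_lift[OF assms(1)] pu_lift[OF assms(2)] pu_index)
    show "pt (loop_ctx \<Gamma>) (\<lambda>x. ?g (fst x) (snd x))"
      by (intro 1 2 pt_if pb_or pb_and pb_less pu_const pu_lift[OF assms(2)] pu_index pb_odd pu_add pu_if
          pu_length pt_lift[OF assms(1)] pt_Cons pt_nil) (auto simp: nsym_def)
  qed
  then show ?thesis unfolding eq .
qed

lemma pt_enc_nat:
  assumes "pu \<Gamma> q"
  shows "pt \<Gamma> (\<lambda>c. enc_nat (q c))"
proof -
  have "enc_nat 1 = [2]" by (simp add: enc_nat.simps[of "Suc 0"] enc_bit_def)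
  then have "pt \<Gamma> (\<lambda>_. enc_nat 1)" by (auto intro!: pt_Cons pt_nil simp: nsym_def)
  from pt_mult[OF this assms] show ?thesis by simp
qed

text \<open>The value may be exponential, but binary lengths are subadditive under multiplication
  and a factor is at least as large as its length, so the sum of the factors bounds the
  accumulator.\<close>

lemma pt_prod:
  assumes "pu \<Gamma> n" "pu (loop_ctx \<Gamma>) (\<lambda>x. f (fst x) (snd x))"
  shows "pt \<Gamma> (\<lambda>c. enc_nat (\<Prod>k<n c. f c k))"
proof -
  obtain p where p: "\<And>c. (\<Sum>k<n c. f c k) \<le> poly p (ctx_size \<Gamma> c)"
    using pu_bound[OF pu_sum[OF assms]] by blast
  let ?F = "\<lambda>c i. enc_nat (\<Prod>k<i. f c k)"
  have "pt \<Gamma> (\<lambda>c. ?F c (length (replicate (n c) (1::nat))))"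
  proof (rule pt_iter[OF assms(1)[unfolded pu_def], where F = ?F and l = "p + 1"])
    show "pt \<Gamma> (\<lambda>c. ?F c 0)" using pt_enc_nat[OF pu_const[of \<Gamma> 1]] by simp
    have "pt (loop_ctx \<Gamma> @ [\<lambda>x. ?F (fst x) (snd x)])
        (\<lambda>x. enc_nat ((\<Prod>k<snd x. f (fst x) k) * f (fst x) (snd x)))"
      by (intro pt_mult pt_var pu_snoc assms) simp
    then show "pt (loop_ctx \<Gamma> @ [\<lambda>x. ?F (fst x) (snd x)]) (\<lambda>x. ?F (fst x) (Suc (snd x)))"
      by simp
  next
    fix c i assume "i \<le> length (replicate (n c) (1::nat))"
    then have i: "i \<le> n c" by simp
    have "length (?F c i) \<le> 1 + (\<Sum>k<i. f c k)" for i
    proof (induction i)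
      case (Suc i)
      have "length (?F c (Suc i)) \<le> length (?F c i) + length (enc_nat (f c i))"
        using length_enc_nat_mult by simp
      then show ?case using Suc length_enc_nat_le[of "f c i"] by simp
    qed (simp add: enc_nat.simps[of "Suc 0"])
    also have "1 + (\<Sum>k<i. f c k) \<le> 1 + (\<Sum>k<n c. f c k)"
      using i by (intro add_mono sum_mono2) auto
    finally show "length (?F c i) \<le> poly (p + 1) (ctx_size \<Gamma> c)" using p[of c] by simp
  qed
  then show ?thesis by simp
qed

section \<open>Primes and schedules\<close>

text \<open>
  The induction follows Leibniz' harmonic triangle: with \<open>L n k = 1 / (k * (n choose k))\<close> one has
  \<open>L n (k + 1) = L (n - 1) k - L n k\<close>, so all entries of row \<open>n\<close> become integers when multiplied
  by a common multiple of \<open>1, \<dots>, n\<close>.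
\<close>

lemma mult_binomial_dvd:
  fixes n k N :: nat
  assumes "\<And>m. 1 \<le> m \<Longrightarrow> m \<le> n \<Longrightarrow> m dvd N" "1 \<le> k" "k \<le> n"
  shows "k * (n choose k) dvd N"
  using assms(2,1,3)
proof (induction k arbitrary: n rule: dec_induct)
  case base
  then show ?case by simp
next
  case (step k)
  obtain n' where n: "n = Suc n'" using step.prems(2) by (cases n) auto
  have le: "k \<le> n'" using step.prems(2) n by simp
  obtain a where a: "N = k * (n' choose k) * a"
    using step.IH[of n'] step.prems(1) le n by (auto elim!: dvdE)
  obtain b where b: "N = k * (n choose k) * b"
    using step.IH[of n] step.prems le n by (auto elim!: dvdE)
  have 1: "Suc k * (n choose Suc k) = (n - k) * (n choose k)"
    using binomial_absorption[of k n] binomial_absorb_comp[of n k] by simp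
  have 2: "(n - k) * (n choose k) = n * (n' choose k)"
    using binomial_absorb_comp[of n k] n by simp
  define P where "P = int (Suc k * (n choose Suc k))"
  have P1: "P = int n * int (n' choose k)"
    unfolding P_def 1 2 by simp
  have P2: "P = (int n - int k) * int (n choose k)"
    unfolding P_def 1 using le n by (simp add: of_nat_diff)
  \<comment> \<open>In terms of the triangle, \<open>a = N * L (n - 1) k\<close>,
    \<open>b = N * L n k\<close> and \<open>P = 1 / L n (k + 1)\<close>, so the recursion reads
    \<open>P * (a - b) = N\<close>. The extra factor \<open>k\<close> lets both factorizations of
    \<open>N\<close> apply.\<close>
  have "int k * (P * (int a - int b)) = int k * int a * P - int k * int b * P"
    by (simp add: algebra_simps)
  also have "int k * int a * P = int n * int (k * (n' choose k) * a)" by (simp add: P1)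
  also have "int k * int b * P = (int n - int k) * int (k * (n choose k) * b)" by (simp add: P2)
  also have "int n * int (k * (n' choose k) * a) - (int n - int k) * int (k * (n choose k) * b) = int k * int N"
    unfolding a[symmetric] b[symmetric] by (simp add: algebra_simps)
  finally have "P * (int a - int b) = int N" using step.hyps by simp
  then have "int (Suc k * (n choose Suc k)) dvd int N" unfolding P_def by (metis dvd_triv_left)
  then show ?case by (simp only: int_dvd_int_iff)
qed

text \<open>A bound of Chebyshev type: \<open>?N\<close> is the least common multiple of
  \<open>1, ..., 2 * m\<close>. It is a multiple of \<open>m * (2 * m choose m)\<close>, hence at
  least \<open>2 ^ m\<close>, while each of its prime powers is at most
  \<open>2 * m\<close>.\<close>

lemma power_two_le_power_prime_count:
  fixes m :: nat
  assumes "m \<ge> 1"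
  shows "2 ^ m \<le> (2 * m) ^ card {p. prime p \<and> p \<le> 2 * m}"
proof -
  let ?n = "2 * m"
  let ?P = "{p. prime p \<and> p \<le> ?n}"
  define ex where "ex p = Max {j. p ^ j \<le> ?n}" for p :: nat
  have fin: "finite {j. p ^ j \<le> ?n}" if "prime p" for p
  proof (rule finite_subset)
    show "{j. p ^ j \<le> ?n} \<subseteq> {..?n}"
    proof
      fix j assume "j \<in> {j. p ^ j \<le> ?n}"
      then have "p ^ j \<le> ?n" by simp
      moreover have "2 ^ j \<le> p ^ j" using prime_ge_2_nat[OF that] by (rule power_mono) simp
      ultimately show "j \<in> {..?n}" using less_exp[of j] unfolding atMost_iff by linarith
    qed
  qed simp
  have exle: "p ^ ex p \<le> ?n" if "prime p" for p
  proof -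
    have "0 \<in> {j. p ^ j \<le> ?n}" using assms by simp
    then have "ex p \<in> {j. p ^ j \<le> ?n}" unfolding ex_def using Max_in[OF fin[OF that]] by blast
    then show ?thesis by simp
  qed
  let ?N = "\<Prod>p\<in>?P. p ^ ex p"
  have finP: "finite ?P" by (rule finite_subset[of _ "{..?n}"]) auto
  have "k dvd ?N" if k: "1 \<le> k" "k \<le> ?n" for k
  proof -
    have "k = (\<Prod>p\<in>prime_factors k. p ^ multiplicity p k)"
      using prime_factorization_nat[of k] k by simp
    also have "\<dots> dvd (\<Prod>p\<in>prime_factors k. p ^ ex p)"
    proof (rule prod_dvd_prod)
      fix p assume p: "p \<in> prime_factors k"
      then have pp: "prime p" by auto
      have "p ^ multiplicity p k \<le> ?n"
        using dvd_imp_le[OF multiplicity_dvd[of p k]] k by simp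
      then have "multiplicity p k \<le> ex p" unfolding ex_def by (intro Max_ge fin pp) simp
      then show "p ^ multiplicity p k dvd p ^ ex p" by (rule le_imp_power_dvd)
    qed
    also have "\<dots> dvd ?N"
    proof (rule prod_dvd_prod_subset[OF finP])
      show "prime_factors k \<subseteq> ?P"
      proof
        fix p assume p: "p \<in> prime_factors k"
        then have "p dvd k" "prime p" by auto
        then show "p \<in> ?P" using dvd_imp_le[of p k] k by simp
      qed
    qed
    finally show ?thesis .
  qed
  then have dvd: "m * (?n choose m) dvd ?N"
    by (rule mult_binomial_dvd) (use assms in auto)
  have "?N > 0" by (rule prod_pos) (auto simp: prime_gt_0_nat)
  then have "m * (?n choose m) \<le> ?N" using dvd by (rule dvd_imp_le[rotated])
  moreover have "?n choose m \<le> m * (?n choose m)" using assms by simp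
  moreover have "2 ^ m \<le> ?n choose m"
  proof -
    have "(real ?n / real m) ^ m \<le> real (?n choose m)"
      using binomial_ge_n_over_k_pow_k[of m ?n, where ?'a = real] by simp
    then have "2 ^ m \<le> real (?n choose m)" using assms by simp
    then show ?thesis by (metis of_nat_le_iff of_nat_numeral of_nat_power)
  qed
  moreover have "?N \<le> (\<Prod>p\<in>?P. ?n)" by (rule prod_mono) (use exle in auto)
  ultimately have "2 ^ m \<le> (\<Prod>p\<in>?P. ?n)" by linarith
  then show ?thesis by simp
qed

text \<open>The previous bound for \<open>32 * e ^ 2\<close>, after estimating the base by
  \<open>64 * e ^ 2 \<le> 2 ^ (6 + 2 * e)\<close> and \<open>6 + 2 * e\<close> by
  \<open>8 * e\<close>. The factor \<open>64\<close> makes the result large enough to leave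
  \<open>2 * e\<close> primes once the small ones are discarded.\<close>

lemma prime_count_lower_bound:
  fixes e :: nat
  assumes "e \<ge> 1"
  shows "4 * e \<le> card {p. prime p \<and> p \<le> 64 * e ^ 2}"
proof -
  let ?c = "card {p. prime p \<and> p \<le> 64 * e ^ 2}"
  have "2 ^ (32 * e ^ 2) \<le> (64 * e ^ 2) ^ ?c"
    using power_two_le_power_prime_count[of "32 * e ^ 2"] assms by simp
  also have "\<dots> \<le> (2 ^ (6 + 2 * e)) ^ ?c"
  proof (rule power_mono)
    have "e ^ 2 \<le> (2 ^ e) ^ 2" by (rule power_mono[OF less_imp_le[OF less_exp]]) simp
    then show "64 * e ^ 2 \<le> 2 ^ (6 + 2 * e)"
      by (simp add: power_add power_mult[symmetric] mult.commute)
  qed simp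
  finally have "(2::nat) ^ (32 * e ^ 2) \<le> 2 ^ ((6 + 2 * e) * ?c)" by (simp add: power_mult)
  then have "32 * e ^ 2 \<le> (6 + 2 * e) * ?c" by simp
  also have "\<dots> \<le> (8 * e) * ?c" by (rule mult_le_mono1) (use assms in simp)
  finally have "(8 * e) * (4 * e) \<le> (8 * e) * ?c" by (simp add: power2_eq_square algebra_simps)
  then show ?thesis using assms by simp
qed

section \<open>Enumeration of the large primes\<close>

definition large_prime :: "nat \<Rightarrow> nat \<Rightarrow> bool" where
  "large_prime e p \<longleftrightarrow> prime p \<and> Suc e < p"

text \<open>At most one summand is nonzero, the large prime with exactly \<open>r\<close> large
  primes below it. A sum takes the place of a search because \<open>pu_sum\<close> and
  \<open>pu_card\<close> can evaluate it; the default is \<open>0\<close>.\<close>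

definition nth_large_prime :: "nat \<Rightarrow> nat \<Rightarrow> nat" where
  "nth_large_prime e r = (\<Sum>m<Suc (64 * e * e).
     if large_prime e m \<and> card {i. i < m \<and> large_prime e i} = r then m else 0)"

lemma nth_large_prime:
  assumes "e \<ge> 1" "r < 2 * e"
  shows "large_prime e (nth_large_prime e r)" "nth_large_prime e r \<le> 64 * e * e"
    and "card {i. i < nth_large_prime e r \<and> large_prime e i} = r"
proof -
  let ?Q = "{p. large_prime e p \<and> p \<le> 64 * e * e}"
  let ?rank = "\<lambda>m. card {i. i < m \<and> large_prime e i}"
  have finQ: "finite ?Q" by (rule finite_subset[of _ "{..64 * e * e}"]) auto
  \<comment> \<open>Primes up to \<open>Suc e\<close> might divide \<open>e\<close> or
    \<open>2\<close>. There are at most \<open>e\<close> of them, so \<open>3 * e\<close> of the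
    \<open>4 * e\<close> primes remain.\<close>
  have "{p. prime p \<and> p \<le> 64 * e ^ 2} \<subseteq> {2..Suc e} \<union> ?Q"
    by (auto simp: large_prime_def prime_ge_2_nat power2_eq_square)
  then have "card {p. prime p \<and> p \<le> 64 * e ^ 2} \<le> card ({2..Suc e} \<union> ?Q)"
    by (intro card_mono) (use finQ in auto)
  also have "\<dots> \<le> card {2..Suc e} + card ?Q" by (rule card_Un_le)
  finally have card: "2 * e \<le> card ?Q" using prime_count_lower_bound[OF assms(1)] by simp
  have mono: "?rank m < ?rank n" if "large_prime e m" "m < n" for m n
    by (rule psubset_card_mono) (use that in auto)
  have inj: "m = n" if "?rank m = ?rank n" "large_prime e m" "large_prime e n" for m n
    using mono[of m n] mono[of n m] that by (metis less_irrefl nat_neq_iff)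
  then have "inj_on ?rank ?Q" by (auto intro!: inj_onI)
  then have "card (?rank ` ?Q) = card {..<card ?Q}" by (simp add: card_image)
  moreover have "?rank ` ?Q \<subseteq> {..<card ?Q}"
  proof safe
    fix m assume "large_prime e m" "m \<le> 64 * e * e"
    then show "?rank m < card ?Q" by (intro psubset_card_mono finQ) auto
  qed
  ultimately have "?rank ` ?Q = {..<card ?Q}" by (intro card_subset_eq) auto
  then have "r \<in> ?rank ` ?Q" using assms(2) card by simp
  then obtain m where m: "large_prime e m" "m \<le> 64 * e * e" "?rank m = r" by auto
  have "(if large_prime e k \<and> ?rank k = r then k else 0) = (if k = m then m else 0)" for k
  proof (cases "k = m")
    case False
    then have "\<not> (large_prime e k \<and> ?rank k = r)" using inj[of k m] m(1,3) by metis
    then show ?thesis using False by (simp only: if_False)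
  qed (use m in simp)
  then have "nth_large_prime e r = m"
    using m(2) by (simp add: nth_large_prime_def less_Suc_eq_le)
  then show "large_prime e (nth_large_prime e r)" "nth_large_prime e r \<le> 64 * e * e" "?rank (nth_large_prime e r) = r"
    using m by auto
qed

lemma nth_large_prime_less:
  assumes "e \<ge> 1" "r < r'" "r' < 2 * e"
  shows "nth_large_prime e r < nth_large_prime e r'"
proof (rule ccontr)
  let ?rank = "\<lambda>m. card {i. i < m \<and> large_prime e i}"
  assume "\<not> nth_large_prime e r < nth_large_prime e r'"
  then have "?rank (nth_large_prime e r') \<le> ?rank (nth_large_prime e r)"
    by (intro card_mono) auto
  then show False using nth_large_prime(3)[of e r] nth_large_prime(3)[of e r'] assms by simp
qed

section \<open>Disjointness of jobs in terms of greatest common divisors\<close>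

lemma job_slots_disjoint_iff:
  "job_slots t p \<inter> job_slots t' p' = {} \<longleftrightarrow> \<not> int (gcd p p') dvd t - t'"
proof -
  have "int (gcd p p') dvd t - t'" if "t + k * int p = t' + k' * int p'" for k k'
  proof -
    have "t - t' = k' * int p' - k * int p" using that by simp
    then show ?thesis by simp
  qed
  moreover have "\<exists>k k'. t + k * int p = t' + k' * int p'" if dvd: "int (gcd p p') dvd t - t'"
  proof -
    obtain u v where "u * int p + v * int p' = int (gcd p p')"
      using bezout_int[of "int p" "int p'"] by auto
    moreover obtain q where "t - t' = int (gcd p p') * q" using dvd by blast
    ultimately have "t - t' = q * u * int p + q * v * int p'" by (metis distrib_left mult.assoc mult.commute)
    then have "t + (- (q * u)) * int p = t' + (q * v) * int p'" by simp
    then show ?thesis by blast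
  qed
  ultimately show ?thesis unfolding job_slots_def by (auto simp: disjoint_iff)
qed

text \<open>Start times are attached to named jobs instead of list positions; periods cannot serve
  as names because all blockers of one attribute share theirs.\<close>

lemma ws_yes_map_iff:
  assumes "distinct js" "\<And>x. x \<in> set js \<Longrightarrow> per x > 0"
  shows "map per js \<in> ws_yes \<longleftrightarrow>
    (\<exists>T. \<forall>x\<in>set js. \<forall>y\<in>set js. x \<noteq> y \<longrightarrow> \<not> int (gcd (per x) (per y)) dvd T x - T y)"
    (is "_ \<longleftrightarrow> ?R")
proof
  assume "map per js \<in> ws_yes"
  then obtain t where "\<forall>j < length (map per js). \<forall>k < length (map per js). j \<noteq> k \<longrightarrow>
      \<not> int (gcd (map per js ! j) (map per js ! k)) dvd t j - t k"
    unfolding ws_yes_def job_slots_disjoint_iff by blast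
  then have t: "\<not> int (gcd (per (js ! j)) (per (js ! k))) dvd t j - t k"
    if "j < length js" "k < length js" "j \<noteq> k" for j k
    using that by simp
  define idx where "idx x = (SOME j. j < length js \<and> js ! j = x)" for x
  have idx: "idx x < length js \<and> js ! idx x = x" if "x \<in> set js" for x
    unfolding idx_def by (rule someI_ex) (use that in \<open>auto simp: in_set_conv_nth\<close>)
  have "\<not> int (gcd (per x) (per y)) dvd t (idx x) - t (idx y)"
    if "x \<in> set js" "y \<in> set js" "x \<noteq> y" for x y
  proof -
    have "idx x \<noteq> idx y" using idx[OF that(1)] idx[OF that(2)] that(3) by auto
    then show ?thesis using t[of "idx x" "idx y"] idx[OF that(1)] idx[OF that(2)] by simp
  qed
  then show ?R by (intro exI[of _ "\<lambda>x. t (idx x)"]) blast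
next
  assume ?R
  then obtain T where T: "\<And>x y. x \<in> set js \<Longrightarrow> y \<in> set js \<Longrightarrow> x \<noteq> y \<Longrightarrow>
      \<not> int (gcd (per x) (per y)) dvd T x - T y" by blast
  have "map per js \<in> ws_instances" using assms(2) by (auto simp: ws_instances_def)
  moreover have "\<not> int (gcd (per (js ! j)) (per (js ! k))) dvd T (js ! j) - T (js ! k)"
    if "j < length js" "k < length js" "j \<noteq> k" for j k
    using T[of "js ! j" "js ! k"] that assms(1) by (simp add: nth_eq_iff_index_eq)
  ultimately show "map per js \<in> ws_yes"
    by (auto simp: ws_yes_def job_slots_disjoint_iff intro!: exI[of _ "\<lambda>j. T (js ! j)"])
qed

text \<open>The gcd splits into a divisor of \<open>a\<close> and one of \<open>b\<close>;
  coprimality forces the former into \<open>c\<close> and the latter into \<open>d\<close>.\<close>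

lemma gcd_mult_dvd:
  fixes a b c d :: nat
  assumes "coprime a d" "coprime b c"
  shows "gcd (a * b) (c * d) dvd gcd a c * gcd b d"
proof -
  obtain x y where xy: "gcd (a * b) (c * d) = x * y" "x dvd a" "y dvd b"
    using division_decomp[of "gcd (a * b) (c * d)" a b] by auto
  have "x * y dvd c * d" using xy(1) by (metis gcd_dvd2)
  then have "x dvd c * d" "y dvd c * d" by (auto dest: dvd_mult_left dvd_mult_right)
  moreover have "coprime x d" using assms(1) xy(2) by (rule coprime_divisors[OF _ dvd_refl, rotated])
  moreover have "coprime y c" using assms(2) xy(3) by (rule coprime_divisors[OF _ dvd_refl, rotated])
  ultimately have "x dvd c" "y dvd d"
    by (simp_all add: coprime_dvd_mult_left_iff coprime_dvd_mult_right_iff)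
  then show ?thesis using xy by (simp add: mult_dvd_mono)
qed

lemma gcd_prod_dvd:
  fixes u v :: "nat \<Rightarrow> nat"
  assumes "\<And>k l. k < n \<Longrightarrow> l < n \<Longrightarrow> k \<noteq> l \<Longrightarrow> coprime (u k) (v l)"
  shows "gcd (\<Prod>k<n. u k) (\<Prod>k<n. v k) dvd (\<Prod>k<n. gcd (u k) (v k))"
  using assms
proof (induction n)
  case (Suc n)
  have 1: "coprime (u n) (\<Prod>k<n. v k)" by (rule prod_coprime_right) (use Suc.prems in auto)
  have 2: "coprime (\<Prod>k<n. u k) (v n)" by (rule prod_coprime_left) (use Suc.prems in auto)
  have "gcd ((\<Prod>k<n. u k) * u n) ((\<Prod>k<n. v k) * v n) dvd
      gcd (\<Prod>k<n. u k) (\<Prod>k<n. v k) * gcd (u n) (v n)"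
    by (rule gcd_mult_dvd[OF 2 1])
  also have "\<dots> dvd (\<Prod>k<n. gcd (u k) (v k)) * gcd (u n) (v n)"
    by (rule mult_dvd_mono) (use Suc in auto)
  finally show ?case by simp
qed simp

lemma prod_dvd_of_coprime:
  fixes u :: "nat \<Rightarrow> nat" and x :: int
  assumes "\<And>k l. k < n \<Longrightarrow> l < n \<Longrightarrow> k \<noteq> l \<Longrightarrow> coprime (u k) (u l)"
    and "\<And>k. k < n \<Longrightarrow> int (u k) dvd x"
  shows "int (\<Prod>k<n. u k) dvd x"
  using assms
proof (induction n)
  case (Suc n)
  have "coprime (\<Prod>k<n. u k) (u n)" by (rule prod_coprime_left) (use Suc.prems in auto)
  then have "coprime (int (\<Prod>k<n. u k)) (int (u n))" by (simp only: coprime_int_iff)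
  then have "int (\<Prod>k<n. u k) * int (u n) dvd x" using Suc by (intro divides_mult) auto
  then show ?case by simp
qed simp

section \<open>From encodings to schedules\<close>

datatype job = Symbol nat | Blocker nat nat

text \<open>The certificate by which jobs are separated below: a modulus common to both periods,
  with two different residues.\<close>

lemma not_gcd_dvd_diff:
  fixes p p' x y m :: nat
  assumes "m dvd p" "m dvd p'" "[x = u] (mod m)" "[y = v] (mod m)" "u < m" "v < m" "u \<noteq> v"
  shows "\<not> int (gcd p p') dvd int x - int y"
proof
  assume "int (gcd p p') dvd int x - int y"
  moreover have "int m dvd int (gcd p p')" using assms(1,2) by simp
  ultimately have "int m dvd int x - int y" by (rule dvd_trans[rotated])
  then have "[int x = int y] (mod int m)" by (simp add: cong_iff_dvd_diff)
  then have "[x = y] (mod m)" by (simp only: cong_int_iff)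
  then have "u mod m = v mod m" using assms(3,4) unfolding cong_def by simp
  then show False using assms(5-7) by simp
qed

lemma div_mod_less:
  fixes r m n :: nat
  assumes "r < m * n"
  shows "r div n < m" "r mod n < n"
  using assms by (auto simp: less_mult_imp_div_less) (metis mod_less_divisor mult_0_right neq0_conv not_less0)

lemma card_eq_one_of_disjoint:
  fixes C :: "nat \<Rightarrow> 'a set"
  assumes "\<And>k. k < n \<Longrightarrow> C k \<subseteq> U" "\<And>k. k < n \<Longrightarrow> C k \<noteq> {}" "finite U" "card U = n"
    and "\<And>k l. k < n \<Longrightarrow> l < n \<Longrightarrow> k \<noteq> l \<Longrightarrow> C k \<inter> C l = {}" and "k < n"
  shows "card (C k) = 1"
proof (rule ccontr)
  assume ne: "card (C k) \<noteq> 1"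
  have fin: "finite (C k)" if "k < n" for k using assms(1)[OF that] assms(3) by (rule finite_subset)
  have ge: "1 \<le> card (C k)" if "k < n" for k
    using fin[OF that] assms(2)[OF that] by (simp add: Suc_le_eq card_gt_0_iff)
  have gt: "1 < card (C k)" using ge[OF assms(6)] ne by linarith
  have "n = (\<Sum>k<n. 1)" by simp
  also have "\<dots> < (\<Sum>k<n. card (C k))"
    by (rule sum_strict_mono_ex1) (use ge gt assms(6) in \<open>auto intro!: bexI[of _ k]\<close>)
  also have "\<dots> = card (\<Union>k<n. C k)"
    by (rule card_UN_disjoint[symmetric]) (use fin assms(5) in auto)
  also have "\<dots> \<le> card U" using assms(1,3) by (intro card_mono) auto
  finally show False using assms(4) by simp
qed

text \<open>Given \<open>b_ge\<close>, the last assumption is equivalent to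
  \<open>(a k - 2) * (b k - 1) > a k * (b k - 2)\<close>: the blockers are too many to leave two
  residues modulo \<open>b k\<close> free.\<close>

locale gadget =
  fixes e :: nat and a b :: "nat \<Rightarrow> nat"
  assumes e_pos: "e > 0"
    and odd_e: "coprime e 2"
    and coprime_a: "\<And>k. k < e \<Longrightarrow> coprime (a k) (e * 2)"
    and coprime_b: "\<And>k. k < e \<Longrightarrow> coprime (b k) (e * 2)"
    and coprime_ab: "\<And>k l. k < e \<Longrightarrow> l < e \<Longrightarrow> coprime (a k) (b l)"
    and coprime_aa: "\<And>k l. k < e \<Longrightarrow> l < e \<Longrightarrow> k \<noteq> l \<Longrightarrow> coprime (a k) (a l)"
    and coprime_bb: "\<And>k l. k < e \<Longrightarrow> l < e \<Longrightarrow> k \<noteq> l \<Longrightarrow> coprime (b k) (b l)"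
    and b_ge: "\<And>k. k < e \<Longrightarrow> b k \<ge> 2"
    and a_gt: "\<And>k. k < e \<Longrightarrow> 2 * b k < a k + 2"
begin

lemma a_ge: "k < e \<Longrightarrow> a k \<ge> 3"
  using a_gt[of k] b_ge[of k] by simp

definition weight :: "nat set \<Rightarrow> nat \<Rightarrow> nat" where
  "weight s k = (if k \<in> s then a k else b k)"

definition num_blockers :: "nat \<Rightarrow> nat" where
  "num_blockers k = (a k - 2) * (b k - 1)"

fun period :: "nat set list \<Rightarrow> job \<Rightarrow> nat" where
  "period S (Symbol j) = (\<Prod>k<e. weight (S ! j) k) * 2"
| "period S (Blocker k r) = e * a k * b k"

definition jobs :: "nat set list \<Rightarrow> job list" where
  "jobs S = map Symbol [0..<length S] @ concat (map (\<lambda>k. map (Blocker k) [0..<num_blockers k]) [0..<e])"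

lemma set_jobs: "set (jobs S) = Symbol ` {..<length S} \<union> {Blocker k r | k r. k < e \<and> r < num_blockers k}"
  by (auto simp: jobs_def)

lemma distinct_jobs: "distinct (jobs S)"
proof -
  have "distinct (concat (map (\<lambda>k. map (Blocker k) [0..<n k]) [0..<m]))" for n m
    by (induction m) (auto simp: distinct_map inj_on_def)
  then show ?thesis by (auto simp: jobs_def distinct_map inj_on_def)
qed

lemma coprime_weight: "k < e \<Longrightarrow> l < e \<Longrightarrow> k \<noteq> l \<Longrightarrow> coprime (weight s k) (weight s' l)"
  using coprime_ab[of k l] coprime_ab[of l k] coprime_aa[of k l] coprime_bb[of k l]
  by (auto simp: weight_def coprime_commute)

lemma coprime_weight_2: "k < e \<Longrightarrow> coprime (weight s k) (e * 2)"
  using coprime_a coprime_b by (auto simp: weight_def)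

lemma weight_dvd_period: "k < e \<Longrightarrow> weight (S ! j) k dvd period S (Symbol j)"
  by (auto intro!: dvd_mult2 dvd_prodI)

lemma period_pos:
  assumes "x \<in> set (jobs S)"
  shows "period S x > 0"
proof -
  have "a k > 0" "b k > 0" if "k < e" for k using a_ge[OF that] b_ge[OF that] by simp_all
  then show ?thesis using assms e_pos by (auto simp: set_jobs weight_def intro!: prod_pos)
qed

text \<open>The other weights are coprime to \<open>e\<close>, \<open>a k\<close> and
  \<open>b k\<close>, and the factor \<open>2\<close> is lost because these are odd. A symbol can
  thus escape a blocker of \<open>k\<close> only modulo its own weight at \<open>k\<close>.\<close>

lemma gcd_symbol_blocker:
  assumes "k < e"
  shows "gcd (period S (Symbol j)) (e * a k * b k) dvd weight (S ! j) k"
proof -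
  let ?w = "weight (S ! j)"
  let ?W = "\<Prod>l\<in>{..<e} - {k}. ?w l"
  have "(\<Prod>l<e. ?w l) = ?w k * ?W" using assms by (simp add: prod.remove)
  then have 1: "period S (Symbol j) = (?w k * 2) * ?W" by simp
  have W: "coprime ?W (e * a k * b k)"
  proof (rule prod_coprime_left)
    fix l assume l: "l \<in> {..<e} - {k}"
    have "coprime (?w l) e" using coprime_weight_2[of l "S ! j"] l by simp
    moreover have "coprime (?w l) (a k)" "coprime (?w l) (b k)"
      using coprime_weight[of l k "S ! j" "{k}"] coprime_weight[of l k "S ! j" "{}"] l assms
      by (auto simp: weight_def)
    ultimately show "coprime (?w l) (e * a k * b k)" by simp
  qed
  have "gcd ((?w k * 2) * ?W) (e * a k * b k) = gcd (?w k * 2) (e * a k * b k)"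
    by (rule gcd_mult_left_right_cancel) (use W in \<open>simp add: coprime_commute\<close>)
  also have "\<dots> = gcd (?w k) (e * a k * b k)"
    by (rule gcd_mult_left_right_cancel)
      (use odd_e coprime_a[OF assms] coprime_b[OF assms] in simp)
  finally show ?thesis unfolding 1 by simp
qed

lemma gcd_blocker_blocker:
  assumes "k < e" "l < e" "k \<noteq> l"
  shows "gcd (e * a k * b k) (e * a l * b l) = e"
proof -
  have "coprime (a k * b k) (a l * b l)"
    using assms coprime_ab[of k l] coprime_ab[of l k] coprime_aa[of k l] coprime_bb[of k l]
    by (simp add: coprime_commute)
  then show ?thesis by (simp add: mult.assoc gcd_mult_distrib_nat[symmetric])
qed

text \<open>Used to force collisions. The gcds of the weights are odd and pairwise coprime, so
  \<open>x\<close> is divisible by twice their product, which the gcd of the periods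
  divides.\<close>

lemma gcd_symbol_symbol_dvd:
  fixes x :: int
  assumes "2 dvd x" "\<And>k. k < e \<Longrightarrow> int (gcd (weight (S ! i) k) (weight (S ! j) k)) dvd x"
  shows "int (gcd (period S (Symbol i)) (period S (Symbol j))) dvd x"
proof -
  let ?g = "\<lambda>k. gcd (weight (S ! i) k) (weight (S ! j) k)"
  have cop: "coprime (?g k) (?g l)" if "k < e" "l < e" "k \<noteq> l" for k l
    by (rule coprime_divisors[OF gcd_dvd1 gcd_dvd2 coprime_weight[OF that]])
  have "int (\<Prod>k<e. ?g k) dvd x" by (rule prod_dvd_of_coprime) (use cop assms(2) in auto)
  moreover have "coprime (\<Prod>k<e. ?g k) 2"
  proof (rule prod_coprime_left)
    fix k assume "k \<in> {..<e}"
    then have "coprime (weight (S ! i) k) 2" using coprime_weight_2[of k "S ! i"] by simp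
    then show "coprime (?g k) 2" by (rule coprime_divisors[OF gcd_dvd1 dvd_refl])
  qed
  then have "coprime (int (\<Prod>k<e. ?g k)) (int 2)" by (simp only: coprime_int_iff)
  ultimately have "int ((\<Prod>k<e. ?g k) * 2) dvd x"
    using divides_mult[of "int (\<Prod>k<e. ?g k)" x "int 2"] assms(1) by simp
  moreover have "gcd (period S (Symbol i)) (period S (Symbol j)) dvd (\<Prod>k<e. ?g k) * 2"
    using gcd_prod_dvd[of e "weight (S ! i)" "weight (S ! j)"] coprime_weight
    by (simp add: gcd_mult_distrib_nat[of 2, symmetric] mult.commute[of _ 2])
  ultimately show ?thesis by (meson dvd_trans int_dvd_int_iff)
qed

text \<open>
  The empty symbol at position \<open>0\<close> is the additional one. Blocker \<open>r\<close> of attribute \<open>k\<close> takes a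
  residue \<open>\<ge> 2\<close> modulo \<open>a k\<close> and a residue \<open>\<ge> 1\<close> modulo \<open>b k\<close>, leaving \<open>{0, 1}\<close> and \<open>{0}\<close> to the
  symbols.
\<close>

lemma schedule_of_encoding:
  assumes "has_feasible_encoding (\<lambda>_. 2) ss" "\<And>s. s \<in> set ss \<Longrightarrow> s \<subseteq> {..<e}"
  shows "\<exists>T. \<forall>x\<in>set (jobs ({} # ss)). \<forall>y\<in>set (jobs ({} # ss)). x \<noteq> y \<longrightarrow>
    \<not> int (gcd (period ({} # ss) x) (period ({} # ss) y)) dvd T x - T y"
proof -
  let ?S = "{} # ss"
  obtain c where c0: "\<forall>j < length ss. \<forall>i \<in> ss ! j. c j i \<in> {0..2 - 1::nat}"
    and cne: "\<forall>j < length ss. \<forall>k < length ss. j \<noteq> k \<longrightarrow> (\<exists>i \<in> ss ! j \<inter> ss ! k. c j i \<noteq> c k i)"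
    using assms(1) unfolding has_feasible_encoding_def feasible_encodings_def is_encoding_def by blast
  have c: "c j i < 2" if "j < length ss" "i \<in> ss ! j" for j i
    using c0 that by fastforce
  \<comment> \<open>Index \<open>e\<close> stands for the modulus \<open>2\<close>. Position
    \<open>j > 0\<close> holds symbol \<open>j - 1\<close> of \<open>ss\<close>, hence the shift in
    \<open>c (j - 1)\<close>.\<close>
  have "\<exists>t. \<forall>i\<in>{..e}. [t = (if i = e then if j = 0 then 0 else 1 else if i \<in> ?S ! j then c (j - 1) i else 0)]
      (mod if i = e then 2 else weight (?S ! j) i)" for j
    by (rule chinese_remainder_nat)
      (use coprime_weight coprime_weight_2 in \<open>auto simp: coprime_commute\<close>)
  then obtain t where t: "\<And>j i. i \<le> e \<Longrightarrow>
      [t j = (if i = e then if j = 0 then 0 else 1 else if i \<in> ?S ! j then c (j - 1) i else 0)]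
      (mod if i = e then 2 else weight (?S ! j) i)"
    by (metis atMost_iff)
  have t2: "[t j = (if j = 0 then 0 else 1)] (mod 2)" for j using t[of e j] by simp
  have tw: "[t j = (if i \<in> ?S ! j then c (j - 1) i else 0)] (mod weight (?S ! j) i)" if "i < e" for i j
    using t[of i j] that by simp
  \<comment> \<open>The indices stand for the moduli \<open>e\<close>, \<open>a k\<close> and
    \<open>b k\<close>. Quotient and remainder of \<open>r\<close> by \<open>b k - 1\<close>
    enumerate the pairs of residues to be blocked.\<close>
  have "\<exists>t. \<forall>i\<in>{0, 1, 2::nat}. [t = (if i = 0 then k else if i = 1 then 2 + r div (b k - 1) else 1 + r mod (b k - 1))]
      (mod if i = 0 then e else if i = 1 then a k else b k)" if "k < e" for k r
    by (rule chinese_remainder_nat)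
      (use coprime_a[OF that] coprime_b[OF that] coprime_ab[OF that that] in \<open>auto simp: coprime_commute\<close>)
  then have "\<exists>t. k < e \<longrightarrow> [t = k] (mod e) \<and> [t = 2 + r div (b k - 1)] (mod a k) \<and>
      [t = 1 + r mod (b k - 1)] (mod b k)" for k r
    by fastforce
  then obtain u where u: "\<And>k r. k < e \<Longrightarrow> [u k r = k] (mod e)"
      "\<And>k r. k < e \<Longrightarrow> [u k r = 2 + r div (b k - 1)] (mod a k)"
      "\<And>k r. k < e \<Longrightarrow> [u k r = 1 + r mod (b k - 1)] (mod b k)"
    by metis
  have ua: "2 + r div (b k - 1) < a k" and ub: "1 + r mod (b k - 1) < b k"
    if "k < e" "r < num_blockers k" for k r
    using div_mod_less[OF that(2)[unfolded num_blockers_def]] b_ge[OF that(1)] a_ge[OF that(1)]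
    by linarith+
  have c': "c (j - 1) i < 2" if "j < length ?S" "i \<in> ?S ! j" for i j
    using that c[of "j - 1" i] by (cases j) auto
  define T where "T x = (case x of Symbol j \<Rightarrow> t j | Blocker k r \<Rightarrow> u k r)" for x
  have sb: "\<not> int (gcd (period ?S (Symbol j)) (period ?S (Blocker k r))) dvd
      int (t j) - int (u k r)"
    if "j < length ?S" "k < e" "r < num_blockers k" for j k r
  proof (cases "k \<in> ?S ! j")
    case True
    show ?thesis
      by (rule not_gcd_dvd_diff[where m = "a k" and u = "c (j - 1) k" and v = "2 + r div (b k - 1)"])
        (use True that u(2)[of k r] tw[of k j] ua[of k r] c'[of j k] a_ge[of k]
            weight_dvd_period[of k ?S j] in \<open>auto simp: weight_def\<close>)
  next
    case False
    show ?thesis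
      by (rule not_gcd_dvd_diff[where m = "b k" and u = 0 and v = "1 + r mod (b k - 1)"])
        (use False that u(3)[of k r] tw[of k j] ub[of k r] b_ge[of k]
            weight_dvd_period[of k ?S j] in \<open>auto simp: weight_def\<close>)
  qed
  have bb: "\<not> int (gcd (period ?S (Blocker k r)) (period ?S (Blocker l q))) dvd
      int (u k r) - int (u l q)"
    if kr: "k < e" "r < num_blockers k" "l < e" "q < num_blockers l" "(k, r) \<noteq> (l, q)" for k r l q
  proof (cases "k = l")
    case False
    show ?thesis
      by (rule not_gcd_dvd_diff[where m = e and u = k and v = l])
        (use False kr u(1)[of k r] u(1)[of l q] in \<open>auto simp: mult.assoc\<close>)
  next
    case True
    consider "r div (b k - 1) \<noteq> q div (b k - 1)" | "r mod (b k - 1) \<noteq> q mod (b k - 1)"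
      using kr(5) True by (metis div_mult_mod_eq)
    then show ?thesis
    proof cases
      case 1
      show ?thesis
        by (rule not_gcd_dvd_diff[where m = "a k" and u = "2 + r div (b k - 1)" and v = "2 + q div (b k - 1)"])
          (use 1 True kr u(2)[of k r] u(2)[of k q] ua[of k r] ua[of k q] in auto)
    next
      case 2
      show ?thesis
        by (rule not_gcd_dvd_diff[where m = "b k" and u = "1 + r mod (b k - 1)" and v = "1 + q mod (b k - 1)"])
          (use 2 True kr u(3)[of k r] u(3)[of k q] ub[of k r] ub[of k q] in auto)
    qed
  qed
  have ss: "\<not> int (gcd (period ?S (Symbol i)) (period ?S (Symbol j))) dvd int (t i) - int (t j)"
    if ij: "i < length ?S" "j < length ?S" "i \<noteq> j" for i j
  proof (cases "i = 0 \<or> j = 0")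
    case True
    show ?thesis
      by (rule not_gcd_dvd_diff[where m = 2 and u = "if i = 0 then 0 else 1" and v = "if j = 0 then 0 else 1"])
        (use True ij t2[of i] t2[of j] in auto)
  next
    case False
    then have "i - 1 < length ss" "j - 1 < length ss" "i - 1 \<noteq> j - 1" using ij by auto
    then obtain k where k: "k \<in> ?S ! i" "k \<in> ?S ! j" "c (i - 1) k \<noteq> c (j - 1) k"
      using cne[rule_format, of "i - 1" "j - 1"] False by (auto simp: nth_Cons')
    have "?S ! i \<in> set ss" using False ij by (auto simp: nth_Cons')
    then have "k < e" using assms(2) k(1) by blast
    show ?thesis
      by (rule not_gcd_dvd_diff[where m = "a k" and u = "c (i - 1) k" and v = "c (j - 1) k"])
        (use k \<open>k < e\<close> ij tw[of k i] tw[of k j] c'[of i k] c'[of j k] a_ge[of k]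
            weight_dvd_period[of k ?S i] weight_dvd_period[of k ?S j] in \<open>auto simp: weight_def\<close>)
  qed
  have "\<not> int (gcd (period ?S x) (period ?S y)) dvd int (T x) - int (T y)"
    if xy: "x \<in> set (jobs ?S)" "y \<in> set (jobs ?S)" "x \<noteq> y" for x y
  proof (cases x; cases y)
    fix i j assume "x = Symbol i" "y = Symbol j"
    then show ?thesis using ss[of i j] xy by (auto simp: set_jobs T_def simp del: period.simps)
  next
    fix i k r assume "x = Symbol i" "y = Blocker k r"
    then show ?thesis using sb[of i k r] xy by (auto simp: set_jobs T_def simp del: period.simps)
  next
    fix i k r assume *: "x = Blocker k r" "y = Symbol i"
    have "int (T x) - int (T y) = - (int (T y) - int (T x))" by simp
    then show ?thesis using * sb[of i k r] xy
      by (auto simp: set_jobs T_def gcd.commute dvd_diff_commute simp del: period.simps)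
  next
    fix k r l q assume "x = Blocker k r" "y = Blocker l q"
    then show ?thesis using bb[of k r l q] xy by (auto simp: set_jobs T_def simp del: period.simps)
  qed
  then show ?thesis by (intro exI[of _ "\<lambda>x. int (T x)"]) blast
qed

end

section \<open>From schedules to encodings\<close>

lemma eq_of_card_le_2:
  assumes "finite D" "card D \<le> 2" "x \<in> D" "y \<in> D" "z \<in> D" "y \<noteq> x" "z \<noteq> x"
  shows "y = z"
proof (rule ccontr)
  assume "y \<noteq> z"
  then have "card {x, y, z} = 3" using assms(6,7) by auto
  moreover have "card {x, y, z} \<le> card D" by (rule card_mono) (use assms in auto)
  ultimately show False using assms(2) by simp
qed

context gadget
begin

lemma encoding_of_schedule:
  fixes T :: "job \<Rightarrow> int"
  assumes T: "\<And>x y. x \<in> set (jobs ({} # ss)) \<Longrightarrow> y \<in> set (jobs ({} # ss)) \<Longrightarrow> x \<noteq> y \<Longrightarrow>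
      \<not> int (gcd (period ({} # ss) x) (period ({} # ss) y)) dvd T x - T y"
    and sub: "\<And>s. s \<in> set ss \<Longrightarrow> s \<subseteq> {..<e}"
  shows "has_feasible_encoding (\<lambda>_. 2) ss"
proof -
  let ?S = "{} # ss"
  let ?t = "\<lambda>j. T (Symbol j)"
  let ?u = "\<lambda>k r. T (Blocker k r)"
  \<comment> \<open>\<open>A k\<close> and \<open>B k\<close> are the residues taken by the blockers
    of \<open>k\<close>; a symbol has to avoid the one or the other, depending on whether it
    contains \<open>k\<close>.\<close>
  define A where "A k = (\<lambda>r. ?u k r mod int (a k)) ` {..<num_blockers k}" for k
  define B where "B k = (\<lambda>r. ?u k r mod int (b k)) ` {..<num_blockers k}" for k
  have N_pos: "num_blockers k > 0" if "k < e" for k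
    using a_ge[OF that] b_ge[OF that] by (simp add: num_blockers_def)
  have dvd_of_mod_eq: "int m dvd x - y" if "x mod int m = y mod int m" for x y :: int and m :: nat
    using that by (simp add: mod_eq_dvd_iff)
  have bb: "?u k r mod int e \<noteq> ?u l q mod int e"
    if "k < e" "r < num_blockers k" "l < e" "q < num_blockers l" "k \<noteq> l" for k r l q
  proof
    assume "?u k r mod int e = ?u l q mod int e"
    then have "int e dvd ?u k r - ?u l q" by (rule dvd_of_mod_eq)
    then show False
      using T[of "Blocker k r" "Blocker l q"] gcd_blocker_blocker[of k l] that by (auto simp: set_jobs)
  qed
  \<comment> \<open>The \<open>e\<close> attributes own disjoint nonempty sets of classes modulo
    \<open>e\<close>, so each set is a singleton.\<close>
  have class_eq: "?u k r mod int e = ?u k q mod int e"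
    if "k < e" "r < num_blockers k" "q < num_blockers k" for k r q
  proof -
    define C where "C k = (\<lambda>r. ?u k r mod int e) ` {..<num_blockers k}" for k
    have "card (C k) = 1"
    proof (rule card_eq_one_of_disjoint[where U = "{0..<int e}" and n = e])
      show "C k \<subseteq> {0..<int e}" for k using e_pos by (auto simp: C_def)
      show "C k \<noteq> {}" if "k < e" for k using N_pos[OF that] by (auto simp: C_def)
      show "C k \<inter> C l = {}" if "k < e" "l < e" "k \<noteq> l" for k l
        using bb that by (fastforce simp: C_def)
    qed (use that in auto)
    then obtain z where z: "C k = {z}" by (rule card_1_singletonE)
    have "?u k r mod int e \<in> C k" "?u k q mod int e \<in> C k" using that by (simp_all add: C_def)
    then show ?thesis unfolding z by simp
  qed
  \<comment> \<open>As blockers of one attribute agree modulo \<open>e\<close>, their pairs of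
    residues must be distinct points of the rectangle \<open>A k \<times> B k\<close>.\<close>
  have card_ge: "num_blockers k \<le> card (A k) * card (B k)" if k: "k < e" for k
  proof -
    let ?f = "\<lambda>r. (?u k r mod int (a k), ?u k r mod int (b k))"
    have "inj_on ?f {..<num_blockers k}"
    proof (rule inj_onI, rule ccontr)
      fix r q assume rq: "r \<in> {..<num_blockers k}" "q \<in> {..<num_blockers k}" "?f r = ?f q" "r \<noteq> q"
      let ?x = "?u k r - ?u k q"
      have "int e dvd ?x" using class_eq[OF k] rq by (auto intro: dvd_of_mod_eq)
      moreover have "int (a k) dvd ?x" "int (b k) dvd ?x" using rq(3) by (auto intro: dvd_of_mod_eq)
      moreover have "coprime (int e) (int (a k))" "coprime (int (e * a k)) (int (b k))"
        unfolding coprime_int_iff using coprime_a[OF k] coprime_b[OF k] coprime_ab[OF k k]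
        by (simp_all add: coprime_commute)
      ultimately have "int (e * a k * b k) dvd ?x" by (simp add: divides_mult)
      then show False using T[of "Blocker k r" "Blocker k q"] rq k by (auto simp: set_jobs)
    qed
    then have "num_blockers k = card (?f ` {..<num_blockers k})" by (simp add: card_image)
    also have "\<dots> \<le> card (A k \<times> B k)"
      by (rule card_mono) (auto simp: A_def B_def)
    finally show ?thesis by (simp add: card_cartesian_product)
  qed
  have symbol_blocker: "?t j mod int (weight (?S ! j) k) \<noteq> ?u k r mod int (weight (?S ! j) k)"
    if "j < length ?S" "k < e" "r < num_blockers k" for j k r
  proof
    assume "?t j mod int (weight (?S ! j) k) = ?u k r mod int (weight (?S ! j) k)"
    then have "int (weight (?S ! j) k) dvd ?t j - ?u k r" by (rule dvd_of_mod_eq)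
    moreover have "int (gcd (period ?S (Symbol j)) (period ?S (Blocker k r))) dvd int (weight (?S ! j) k)"
      using gcd_symbol_blocker[OF that(2), of ?S j] by (simp only: int_dvd_int_iff period.simps)
    ultimately show False
      using T[of "Symbol j" "Blocker k r"] that dvd_trans by (fastforce simp: set_jobs simp del: period.simps)
  qed
  have notA: "?t j mod int (a k) \<in> {0..<int (a k)} - A k" if "j < length ?S" "k < e" "k \<in> ?S ! j" for j k
    using symbol_blocker[OF that(1,2)] that(3) a_ge[OF that(2)] by (auto simp: A_def weight_def)
  have notB: "?t j mod int (b k) \<in> {0..<int (b k)} - B k" if "j < length ?S" "k < e" "k \<notin> ?S ! j" for j k
    using symbol_blocker[OF that(1,2)] that(3) b_ge[OF that(2)] by (auto simp: B_def weight_def)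
  have A_sub: "A k \<subseteq> {0..<int (a k)}" and B_sub: "B k \<subseteq> {0..<int (b k)}" if "k < e" for k
    using a_ge[OF that] b_ge[OF that] by (auto simp: A_def B_def)
  have fin: "finite (A k)" "finite (B k)" for k by (simp_all add: A_def B_def)
  have card_A: "card ({0..<int (a k)} - A k) \<le> 2" and card_B: "card ({0..<int (b k)} - B k) = 1"
    if k: "k < e" for k
  proof -
    have cA: "card ({0..<int (a k)} - A k) = a k - card (A k)" "card (A k) \<le> a k"
      using card_Diff_subset[OF fin(1) A_sub[OF k]] card_mono[OF _ A_sub[OF k]] by simp_all
    have cB: "card ({0..<int (b k)} - B k) = b k - card (B k)" "card (B k) \<le> b k"
      using card_Diff_subset[OF fin(2) B_sub[OF k]] card_mono[OF _ B_sub[OF k]] by simp_all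
    \<comment> \<open>Position \<open>0\<close> is the empty symbol; its residue modulo
      \<open>b k\<close> is free of blockers.\<close>
    have "{0..<int (b k)} - B k \<noteq> {}" using notB[of 0 k] k by auto
    then have B_le: "card (B k) \<le> b k - 1"
      using cB b_ge[OF k] by (metis One_nat_def Suc_leI card_gt_0_iff diff_le_mono2 diff_diff_cancel
          finite_Diff finite_atLeastLessThan_int)
    have "(a k - 2) * (b k - 1) \<le> card (A k) * (b k - 1)"
      using card_ge[OF k] B_le unfolding num_blockers_def by (meson le_trans mult_le_mono2)
    then have A_ge: "a k - 2 \<le> card (A k)" using b_ge[OF k] by simp
    then show "card ({0..<int (a k)} - A k) \<le> 2" using cA by linarith
    \<comment> \<open>Otherwise even all residues modulo \<open>a k\<close> yield too few pairs:
      with \<open>x = a k - 2\<close> and \<open>y = b k - 2\<close>, counting gives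
      \<open>x \<le> 2 * y\<close>, but \<open>a_gt\<close> says \<open>2 * y < x\<close>.\<close>
    have "b k - 1 \<le> card (B k)"
    proof (rule ccontr)
      assume "\<not> b k - 1 \<le> card (B k)"
      then have "card (A k) * card (B k) \<le> a k * (b k - 2)"
        using cA(2) by (intro mult_le_mono) auto
      then have le: "(a k - 2) * (b k - 1) \<le> a k * (b k - 2)"
        using card_ge[OF k] unfolding num_blockers_def by simp
      obtain x where x: "a k = x + 2" using a_ge[OF k] by (metis add.commute le_Suc_ex numeral_3_eq_3 Suc_leD numeral_2_eq_2)
      obtain y where y: "b k = y + 2" using b_ge[OF k] by (metis add.commute le_Suc_ex)
      have "x \<le> 2 * y" using le unfolding x y by (simp add: algebra_simps)
      then show False using a_gt[OF k] x y by simp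
    qed
    then show "card ({0..<int (b k)} - B k) = 1" using cB B_le b_ge[OF k] by linarith
  qed
  have B_eq: "?t i mod int (b k) = ?t j mod int (b k)"
    if "i < length ?S" "j < length ?S" "k < e" "k \<notin> ?S ! i" "k \<notin> ?S ! j" for i j k
    using card_B[OF that(3)] notB[OF that(1,3,4)] notB[OF that(2,3,5)]
    by (metis card_1_singletonE singletonD)
  \<comment> \<open>The last premise concerns only common attributes. Otherwise both weights are
    \<open>b k\<close>, with a single free residue by \<open>B_eq\<close>, or they are
    coprime.\<close>
  have gcd_dvd: "int (gcd (weight (?S ! i) k) (weight (?S ! j) k)) dvd ?t i - ?t j"
    if "i < length ?S" "j < length ?S" "k < e"
      "\<lbrakk>k \<in> ?S ! i; k \<in> ?S ! j\<rbrakk> \<Longrightarrow> ?t i mod int (a k) = ?t j mod int (a k)" for i j k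
  proof -
    consider "k \<in> ?S ! i" "k \<in> ?S ! j" | "k \<notin> ?S ! i" "k \<notin> ?S ! j" | "(k \<in> ?S ! i) \<noteq> (k \<in> ?S ! j)"
      by blast
    then show ?thesis
    proof cases
      case 1
      then show ?thesis using dvd_of_mod_eq[OF that(4)] by (simp add: weight_def)
    next
      case 2
      then show ?thesis using dvd_of_mod_eq[OF B_eq[OF that(1-3)]] by (simp add: weight_def)
    next
      case 3
      then have "gcd (weight (?S ! i) k) (weight (?S ! j) k) = 1"
        using coprime_ab[OF that(3,3)] by (auto simp: weight_def coprime_iff_gcd_eq_1 gcd.commute)
      then show ?thesis by simp
    qed
  qed
  \<comment> \<open>The empty symbol has no attribute in common with any other, so no weight can
    separate them and only the modulus \<open>2\<close> is left.\<close>
  have parity: "?t j mod 2 \<noteq> ?t 0 mod 2" if "0 < j" "j < length ?S" for j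
  proof
    assume "?t j mod 2 = ?t 0 mod 2"
    then have "2 dvd ?t j - ?t 0" by (simp add: mod_eq_dvd_iff)
    then have "int (gcd (period ?S (Symbol j)) (period ?S (Symbol 0))) dvd ?t j - ?t 0"
      by (rule gcd_symbol_symbol_dvd) (use gcd_dvd[of j 0] that in auto)
    then show False using T[of "Symbol j" "Symbol 0"] that by (auto simp: set_jobs simp del: period.simps)
  qed
  \<comment> \<open>The bit marks the least free residue modulo \<open>a k\<close>. As at most two
    residues are free, different residues of symbols containing \<open>k\<close> get different
    bits.\<close>
  define c where "c j k = (if ?t (Suc j) mod int (a k) = Min ({0..<int (a k)} - A k) then 0 else 1 :: nat)" for j k
  have "\<exists>k\<in>ss ! i \<inter> ss ! j. c i k \<noteq> c j k" if ij: "i < length ss" "j < length ss" "i \<noteq> j" for i j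
  proof -
    let ?i = "Suc i" and ?j = "Suc j"
    have "\<not> int (gcd (period ?S (Symbol ?i)) (period ?S (Symbol ?j))) dvd ?t ?i - ?t ?j"
      using T[of "Symbol ?i" "Symbol ?j"] ij by (auto simp: set_jobs simp del: period.simps)
    moreover have "?t ?i mod 2 = ?t ?j mod 2"
      using parity[of ?i] parity[of ?j] ij by (simp add: mod2_eq_if split: if_splits)
    then have "2 dvd ?t ?i - ?t ?j" by (simp add: mod_eq_dvd_iff)
    ultimately have "\<exists>k<e. \<not> int (gcd (weight (?S ! ?i) k) (weight (?S ! ?j) k)) dvd ?t ?i - ?t ?j"
      using gcd_symbol_symbol_dvd[of "?t ?i - ?t ?j" ?S ?i ?j] by blast
    then obtain k where k: "k < e" "k \<in> ?S ! ?i" "k \<in> ?S ! ?j"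
        "?t ?i mod int (a k) \<noteq> ?t ?j mod int (a k)"
      using gcd_dvd[of ?i ?j] ij by fastforce
    let ?D = "{0..<int (a k)} - A k"
    have D: "?t ?i mod int (a k) \<in> ?D" "?t ?j mod int (a k) \<in> ?D"
      using notA[of ?i k] notA[of ?j k] k ij by auto
    have "Min ?D \<in> ?D" by (rule Min_in) (use D(1) in auto)
    then have "?t ?i mod int (a k) = Min ?D \<or> ?t ?j mod int (a k) = Min ?D"
      using eq_of_card_le_2[OF _ card_A[OF k(1)] _ D, of "Min ?D"] k(4) by blast
    then have "c i k \<noteq> c j k" using k(4) by (auto simp: c_def)
    then show ?thesis using k(2,3) by auto
  qed
  moreover have "is_encoding (\<lambda>_. 2) s (c j)" for s j by (simp add: is_encoding_def c_def)
  ultimately show ?thesis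
    unfolding has_feasible_encoding_def feasible_encodings_def by blast
qed

theorem ws_yes_jobs_iff:
  assumes "\<And>s. s \<in> set ss \<Longrightarrow> s \<subseteq> {..<e}"
  shows "map (period ({} # ss)) (jobs ({} # ss)) \<in> ws_yes \<longleftrightarrow> has_feasible_encoding (\<lambda>_. 2) ss"
proof -
  have "map (period ({} # ss)) (jobs ({} # ss)) \<in> ws_yes \<longleftrightarrow>
      (\<exists>T. \<forall>x\<in>set (jobs ({} # ss)). \<forall>y\<in>set (jobs ({} # ss)). x \<noteq> y \<longrightarrow>
        \<not> int (gcd (period ({} # ss) x) (period ({} # ss) y)) dvd T x - T y)"
    by (rule ws_yes_map_iff[OF distinct_jobs]) (rule period_pos)
  also have "\<dots> \<longleftrightarrow> has_feasible_encoding (\<lambda>_. 2) ss"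
    using schedule_of_encoding[of ss, OF _ assms] encoding_of_schedule[of ss, OF _ assms] by meson
  finally show ?thesis .
qed

end

section \<open>The reduction\<close>

text \<open>
  The square makes \<open>code_a e k\<close> exceed \<open>2 * code_b e k\<close>, since it belongs to the next larger prime.
\<close>

definition code_a :: "nat \<Rightarrow> nat \<Rightarrow> nat" where
  "code_a e k = nth_large_prime e (Suc (2 * k)) * nth_large_prime e (Suc (2 * k))"

definition code_b :: "nat \<Rightarrow> nat \<Rightarrow> nat" where
  "code_b e k = nth_large_prime e (2 * k)"

lemma gadget_code:
  assumes "odd e"
  shows "gadget e (code_a e) (code_b e)"
proof -
  let ?p = "nth_large_prime e"
  have e: "e \<ge> 1" using assms by (cases e) auto
  have p: "prime (?p r)" "Suc e < ?p r" if "r < 2 * e" for r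
    using nth_large_prime(1)[OF e that] by (auto simp: large_prime_def)
  have less: "?p r < ?p r'" if "r < r'" "r' < 2 * e" for r r'
    by (rule nth_large_prime_less[OF e that])
  have coprime: "coprime (?p r) (?p r')" if "r < 2 * e" "r' < 2 * e" "r \<noteq> r'" for r r'
  proof -
    have "?p r \<noteq> ?p r'" using less[of r r'] less[of r' r] that by (cases "r < r'") auto
    then show ?thesis using that by (intro primes_coprime p)
  qed
  have coprime_e: "coprime (?p r) e" "coprime (?p r) 2" if "r < 2 * e" for r
  proof -
    have "\<not> ?p r dvd e" "\<not> ?p r dvd 2" using p(2)[OF that] e by (auto dest!: dvd_imp_le)
    then show "coprime (?p r) e" "coprime (?p r) 2"
      using prime_imp_coprime_nat[OF p(1)[OF that]] by blast+
  qed
  show ?thesis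
  proof
    show "e > 0" "coprime e 2" using e assms by simp_all
    fix k assume k: "k < e"
    show "coprime (code_a e k) (e * 2)" "coprime (code_b e k) (e * 2)"
      using coprime_e[of "2 * k"] coprime_e[of "Suc (2 * k)"] k by (simp_all add: code_a_def code_b_def)
    show "2 \<le> code_b e k" using p(2)[of "2 * k"] k by (simp add: code_b_def)
    have "Suc (?p (2 * k)) \<le> ?p (Suc (2 * k))" using less[of "2 * k" "Suc (2 * k)"] k by simp
    then have "Suc (?p (2 * k)) * Suc (?p (2 * k)) \<le> code_a e k"
      unfolding code_a_def by (rule mult_le_mono) fact
    then show "2 * code_b e k < code_a e k + 2" by (simp add: code_b_def)
    fix l assume l: "l < e"
    have "2 * l \<noteq> Suc (2 * k)" by presburger
    then show "coprime (code_a e k) (code_b e l)"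
      using coprime[of "Suc (2 * k)" "2 * l"] k l by (simp add: code_a_def code_b_def)
    assume "k \<noteq> l"
    then show "coprime (code_a e k) (code_a e l)" "coprime (code_b e k) (code_b e l)"
      using coprime[of "Suc (2 * k)" "Suc (2 * l)"] coprime[of "2 * k" "2 * l"] k l
      by (simp_all add: code_a_def code_b_def)
  qed
qed

lemma code_le:
  assumes "e \<ge> 1" "k < e"
  shows "code_a e k \<le> (64 * e * e) ^ 2" "code_b e k \<le> 64 * e * e"
proof -
  have "nth_large_prime e (Suc (2 * k)) \<le> 64 * e * e"
    using assms by (intro nth_large_prime(2)) auto
  then show "code_a e k \<le> (64 * e * e) ^ 2"
    unfolding code_a_def power2_eq_square by (rule mult_le_mono) fact
  show "code_b e k \<le> 64 * e * e"
    unfolding code_b_def using assms by (intro nth_large_prime(2)) auto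
qed

text \<open>
  The number of attributes is padded to \<open>2 * d + 1\<close> because the common modulus of the blockers
  must be odd. Attribute \<open>0\<close> and those above \<open>d\<close> belong to no symbol.
\<close>

definition reduction :: "nat \<times> nat set list \<Rightarrow> nat list" where
  "reduction = (\<lambda>(d, ss). let e = 2 * d + 1 in
     map (gadget.period e (code_a e) (code_b e) ({} # ss)) (gadget.jobs e (code_a e) (code_b e) ({} # ss)))"

text \<open>By \<open>d \<ge> 2\<close>, constants become powers of \<open>d\<close>:
  \<open>64 * 3 * 3 = 576 \<le> 2 ^ 10\<close> bounds the primes by \<open>d ^ 12\<close> and the
  weights by \<open>d ^ 24\<close>. A symbol has \<open>2 * d + 1\<close> weights and the factor
  \<open>2 \<le> d\<close>, so its exponent is \<open>24 * (2 * d + 1) + 1\<close>.\<close>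

lemma reduction_bound:
  assumes "d \<ge> 2" "p \<in> set (reduction (d, ss))"
  shows "p \<le> d ^ (48 * d + 25)"
proof -
  define e where "e = 2 * d + 1"
  interpret gadget e "code_a e" "code_b e" by (rule gadget_code) (simp add: e_def)
  have e: "e \<ge> 1" by (simp add: e_def)
  have d2: "4 \<le> d ^ 2" "2 ^ 10 \<le> d ^ 10"
    using power_mono[of 2 d 2] power_mono[of 2 d 10] assms(1) by simp_all
  have e_le: "e \<le> 3 * d" using assms(1) by (simp add: e_def)
  have "3 * d \<le> d ^ 2 * d" by (rule mult_le_mono1) (use d2(1) in linarith)
  also have "d ^ 2 * d = d ^ 3" by (simp add: power2_eq_square power3_eq_cube)
  finally have e_le3: "e \<le> d ^ 3" using e_le by linarith
  have "64 * e * e \<le> 64 * (3 * d) * (3 * d)" using e_le by (intro mult_le_mono) auto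
  also have "\<dots> = 576 * d ^ 2" by (simp add: power2_eq_square)
  also have "\<dots> \<le> d ^ 10 * d ^ 2" using d2(2) by (intro mult_le_mono1) simp
  finally have prime_le: "64 * e * e \<le> d ^ 12" by (simp flip: power_add)
  have b_le: "code_b e k \<le> d ^ 12" if "k < e" for k
    using code_le(2)[OF e that] prime_le by simp
  have a_le: "code_a e k \<le> d ^ 24" if "k < e" for k
  proof -
    have "code_a e k \<le> (64 * e * e) ^ 2" by (rule code_le(1)[OF e that])
    also have "\<dots> \<le> (d ^ 12) ^ 2" using prime_le by (rule power_mono) simp
    finally show ?thesis by (simp flip: power_mult)
  qed
  have "d ^ 12 \<le> d ^ 24" using assms(1) by (intro power_increasing) auto
  then have weight_le: "weight s k \<le> d ^ 24" if "k < e" for s k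
    using a_le[OF that] b_le[OF that] by (simp add: weight_def)
  obtain x where x: "x \<in> set (jobs ({} # ss))" "p = period ({} # ss) x"
    using assms(2) by (auto simp: reduction_def Let_def e_def)
  show ?thesis
  proof (cases x)
    case (Symbol j)
    have "(\<Prod>k<e. weight (({} # ss) ! j) k) \<le> (\<Prod>k<e. d ^ 24)"
      by (rule prod_mono) (use weight_le in auto)
    then have "p \<le> (d ^ 24) ^ e * d" using x Symbol assms(1) by (simp add: mult_le_mono)
    also have "\<dots> = d ^ (24 * e + 1)" by (simp flip: power_mult)
    also have "24 * e + 1 = 48 * d + 25" by (simp add: e_def)
    finally show ?thesis .
  next
    case (Blocker k r)
    then have k: "k < e" using x(1) by (auto simp: set_jobs)
    have "p \<le> d ^ 3 * d ^ 24 * d ^ 12"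
      unfolding x(2) Blocker period.simps by (intro mult_le_mono e_le3 a_le[OF k] b_le[OF k])
    also have "\<dots> = d ^ 39" by (simp flip: power_add)
    also have "\<dots> \<le> d ^ (48 * d + 25)" using assms(1) by (intro power_increasing) auto
    finally show ?thesis .
  qed
qed

lemma reduction_instance: "reduction (d, ss) \<in> ws_instances"
proof -
  interpret gadget "2 * d + 1" "code_a (2 * d + 1)" "code_b (2 * d + 1)" by (rule gadget_code) simp
  show ?thesis using period_pos by (auto simp: reduction_def ws_instances_def Let_def)
qed

lemma reduction_correct:
  assumes "(d, ss) \<in> bpc_instances"
  shows "(d, ss) \<in> bpc_yes \<longleftrightarrow> reduction (d, ss) \<in> ws_yes"
proof -
  interpret gadget "2 * d + 1" "code_a (2 * d + 1)" "code_b (2 * d + 1)" by (rule gadget_code) simp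
  have "s \<subseteq> {..<2 * d + 1}" if "s \<in> set ss" for s
    using assms that by (fastforce simp: bpc_instances_def partial_coding_instance_def)
  from ws_yes_jobs_iff[of ss, OF this] show ?thesis
    using assms by (simp add: reduction_def bpc_yes_def Let_def)
qed

section \<open>The reduction as a function on strings\<close>

text \<open>
  Seen as a table, the input has one row per symbol, all of length \<open>d + 1\<close> and ending with \<open>3\<close>,
  preceded by a header row that takes the place of the additional empty symbol.
\<close>

definition num_rows :: "nat list \<Rightarrow> nat" where
  "num_rows x = card {i. i < length x \<and> top0 (drop i x) = 3}"

text \<open>A quotient obtained by counting; on encoded instances it is \<open>Suc d\<close>,
  terminator included.\<close>

definition row_length :: "nat list \<Rightarrow> nat" where
  "row_length x = card {i. i < length x \<and> i * num_rows x < length x}"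

text \<open>The padded number \<open>2 * d + 1\<close>, written as \<open>Suc d + d\<close>.\<close>

definition attributes :: "nat list \<Rightarrow> nat" where
  "attributes x = row_length x + (row_length x - 1)"

text \<open>The header consists of twos but plays the empty symbol, hence \<open>0 < j\<close>.
  Attributes start at \<open>1\<close>, so \<open>k\<close> is found in column \<open>k - 1\<close>,
  and the bound on \<open>k\<close> excludes the terminator.\<close>

definition contains :: "nat list \<Rightarrow> nat \<Rightarrow> nat \<Rightarrow> bool" where
  "contains x j k \<longleftrightarrow> 0 < j \<and> 0 < k \<and> k < row_length x \<and> top0 (drop (j * row_length x + (k - 1)) x) = 2"

definition reduction_string :: "nat list \<Rightarrow> nat list" where
  "reduction_string x =
     concat (map (\<lambda>j. enc_nat ((\<Prod>k<attributes x. if contains x j k then code_a (attributes x) k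
       else code_b (attributes x) k) * 2) @ [3]) [0..<num_rows x]) @
     concat (map (\<lambda>k. concat (map (\<lambda>_. enc_nat (attributes x * code_a (attributes x) k * code_b (attributes x) k) @ [3])
       [0..<(code_a (attributes x) k - 2) * (code_b (attributes x) k - 1)])) [0..<attributes x])"

lemma pu_nth_large_prime:
  assumes "pu \<Gamma> e" "pu \<Gamma> r"
  shows "pu \<Gamma> (\<lambda>c. nth_large_prime (e c) (r c))"
  unfolding nth_large_prime_def large_prime_def
  by (intro pu_sum pu_Suc pu_mult pu_const assms pu_if pb_and pb_prime pu_index pb_less pu_lift pb_eq pu_card)

lemma pu_code_a: "pu \<Gamma> e \<Longrightarrow> pu \<Gamma> k \<Longrightarrow> pu \<Gamma> (\<lambda>c. code_a (e c) (k c))"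
  unfolding code_a_def by (intro pu_mult pu_nth_large_prime pu_Suc pu_const)

lemma pu_code_b: "pu \<Gamma> e \<Longrightarrow> pu \<Gamma> k \<Longrightarrow> pu \<Gamma> (\<lambda>c. code_b (e c) (k c))"
  unfolding code_b_def by (intro pu_mult pu_nth_large_prime pu_const)

lemma pu_num_rows: "pt \<Gamma> x \<Longrightarrow> pu \<Gamma> (\<lambda>c. num_rows (x c))"
  unfolding num_rows_def by (intro pu_card pu_length pb_top pt_drop pt_lift pu_index)

lemma pu_row_length: "pt \<Gamma> x \<Longrightarrow> pu \<Gamma> (\<lambda>c. row_length (x c))"
  unfolding row_length_def
  by (intro pu_card pu_length pb_less pu_mult pu_index pu_lift pu_num_rows)

lemma pu_attributes: "pt \<Gamma> x \<Longrightarrow> pu \<Gamma> (\<lambda>c. attributes (x c))"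
  unfolding attributes_def by (intro pu_add pu_diff pu_const pu_row_length)

lemma pb_contains:
  "pt \<Gamma> x \<Longrightarrow> pu \<Gamma> j \<Longrightarrow> pu \<Gamma> k \<Longrightarrow> pb \<Gamma> (\<lambda>c. contains (x c) (j c) (k c))"
  unfolding contains_def
  by (intro pb_and pb_less pu_const pu_row_length pb_top pt_drop pu_add pu_mult pu_diff)

lemma pt_reduction_string: "pt [\<lambda>x. x] reduction_string"
proof -
  let ?\<Gamma> = "[\<lambda>x. x] :: (nat list \<Rightarrow> nat list) list"
  have x: "pt ?\<Gamma> (\<lambda>x. x)" by (rule pt_var) simp
  \<comment> \<open>The input as seen from inside one loop and, next, inside two nested
    loops.\<close>
  note x1 = pt_lift[OF x]
  note x2 = pt_lift[OF x1]
  have three: "pt \<Gamma> (\<lambda>_. [3])" for \<Gamma> :: "('c \<Rightarrow> nat list) list"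
    by (intro pt_Cons pt_nil) (auto simp: nsym_def)
  have "pt ?\<Gamma> (\<lambda>x. concat (map (\<lambda>j. enc_nat ((\<Prod>k<attributes x. if contains x j k then code_a (attributes x) k
       else code_b (attributes x) k) * 2) @ [3]) [0..<num_rows x]))"
    by (intro pt_concat pu_num_rows x pt_append three pt_mult pu_const pt_prod pu_attributes x1 pu_if
        pb_contains x2 pu_lift[OF pu_index] pu_index pu_code_a pu_code_b)
  moreover have "pt ?\<Gamma> (\<lambda>x. concat (map (\<lambda>k. concat (map (\<lambda>_. enc_nat (attributes x * code_a (attributes x) k * code_b (attributes x) k) @ [3])
       [0..<(code_a (attributes x) k - 2) * (code_b (attributes x) k - 1)])) [0..<attributes x]))"
    by (intro pt_concat x pt_append three pt_mult pt_enc_nat pu_mult pu_diff pu_const pu_attributes x1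
        x2 pu_lift[OF pu_index] pu_index pu_code_a pu_code_b)
  ultimately show ?thesis unfolding reduction_string_def by (intro pt_append)
qed

lemma top0_drop: "i < length x \<Longrightarrow> top0 (drop i x) = x ! i"
  by (simp add: top0_def hd_drop_conv_nth)

lemma concat_uniform_nth:
  assumes "\<And>r. r \<in> set rows \<Longrightarrow> length r = m" "j < length rows" "i < m"
  shows "concat rows ! (j * m + i) = rows ! j ! i"
  using assms
proof (induction rows arbitrary: j)
  case (Cons r rows)
  show ?case
  proof (cases j)
    case 0
    then show ?thesis using Cons.prems by (simp add: nth_append)
  next
    case (Suc j')
    have "concat rows ! (j' * m + i) = rows ! j' ! i" using Cons Suc by auto
    then show ?thesis using Cons.prems(1)[of r] Suc by (simp add: nth_append add.assoc)
  qed
qed simp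

lemma concat_concat: "concat (concat xss) = concat (map concat xss)"
  by (induction xss) auto

lemma reduction_string_eq:
  assumes "(d, ss) \<in> bpc_instances"
  shows "reduction_string (enc_bpc (d, ss)) = enc_ws (reduction (d, ss))"
proof -
  define x where "x = enc_bpc (d, ss)"
  define e where "e = 2 * d + 1"
  interpret gadget e "code_a e" "code_b e" by (rule gadget_code) (simp add: e_def)
  let ?row = "\<lambda>s. map (\<lambda>i. enc_bit (i \<in> s)) [1..<Suc d] @ [3]"
  define rows where "rows = (replicate d 2 @ [3]) # map ?row ss"
  have x_eq: "x = concat rows" by (simp add: x_def enc_bpc_def rows_def)
  have row_len: "length r = Suc d" if "r \<in> set rows" for r using that by (auto simp: rows_def)
  have len_rows: "length rows = Suc (length ss)" by (simp add: rows_def)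
  have len: "length x = Suc d * Suc (length ss)"
  proof -
    have "length x = (\<Sum>r\<leftarrow>rows. Suc d)"
      unfolding x_eq length_concat using row_len by (metis (no_types, lifting) map_eq_conv)
    then show ?thesis by (simp add: sum_list_triv len_rows)
  qed
  have num: "num_rows x = Suc (length ss)"
  proof -
    \<comment> \<open>Each row, the header included, has its only \<open>3\<close> at the end, so
      counting terminators counts rows.\<close>
    have "filter (\<lambda>a. a = 3) r = [3]" if "r \<in> set rows" for r
      using that by (auto simp: rows_def filter_empty_conv enc_bit_def)
    then have eq: "map (filter (\<lambda>a. a = 3)) rows = map (\<lambda>_. [3]) rows" by simp
    have "length (filter (\<lambda>a. a = 3) x) = length rows"
      unfolding x_eq filter_concat eq by (simp add: length_concat comp_def sum_list_triv)
    moreover have "{i. i < length x \<and> top0 (drop i x) = 3} = {i. i < length x \<and> x ! i = 3}"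
      by (auto simp: top0_drop)
    ultimately show ?thesis by (simp add: num_rows_def length_filter_conv_card len_rows)
  qed
  have row: "row_length x = Suc d"
  proof -
    have "{i. i < length x \<and> i * num_rows x < length x} = {..<Suc d}"
      unfolding num len by (auto simp only: mult_less_cancel2 lessThan_iff) simp_all
    then show ?thesis by (simp add: row_length_def)
  qed
  have attr: "attributes x = e" by (simp add: attributes_def row e_def)
  have contains: "contains x j k \<longleftrightarrow> k \<in> ({} # ss) ! j" if j: "j < Suc (length ss)" for j k
  proof (cases "0 < j \<and> 0 < k \<and> k < Suc d")
    case True
    then obtain j' where j': "j = Suc j'" "j' < length ss" using j by (cases j) auto
    have "j * Suc d + (k - 1) < Suc j * Suc d" using True by (simp add: algebra_simps) linarith
    also have "\<dots> \<le> length x" unfolding len using j by (metis Suc_leI mult.commute mult_le_mono2)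
    finally have "top0 (drop (j * Suc d + (k - 1)) x) = x ! (j * Suc d + (k - 1))" by (rule top0_drop)
    also have "\<dots> = rows ! j ! (k - 1)"
      unfolding x_eq by (rule concat_uniform_nth) (use row_len j len_rows True in auto)
    also have "\<dots> = enc_bit (k \<in> ss ! j')"
    proof -
      have "k - 1 < d" using True by linarith
      then show ?thesis using True j' by (simp add: rows_def nth_append del: upt_Suc)
    qed
    finally show ?thesis using True j' by (simp add: contains_def row enc_bit_def)
  next
    case False
    have "k \<notin> ({} # ss) ! j"
    proof
      assume k: "k \<in> ({} # ss) ! j"
      then obtain j' where j': "j = Suc j'" by (cases j) auto
      then have "ss ! j' \<subseteq> {1..d}"
        using assms j by (auto simp: bpc_instances_def partial_coding_instance_def)
      then show False using k j' False by auto
    qed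
    then show ?thesis using False by (auto simp: contains_def row)
  qed
  have period_Symbol: "period ({} # ss) (Symbol j) =
      (\<Prod>k<e. if contains x j k then code_a e k else code_b e k) * 2" if "j < Suc (length ss)" for j
    using contains[OF that] by (simp add: weight_def)
  let ?enc = "\<lambda>p. enc_nat p @ [3]"
  have "enc_ws (reduction (d, ss)) =
      concat (map (\<lambda>j. ?enc (period ({} # ss) (Symbol j))) [0..<Suc (length ss)]) @
      concat (map (\<lambda>k. concat (map (\<lambda>_. ?enc (e * code_a e k * code_b e k)) [0..<num_blockers k])) [0..<e])"
    unfolding reduction_def e_def[symmetric] Let_def prod.case enc_ws_def jobs_def
    by (simp add: map_concat comp_def concat_concat del: upt_Suc period.simps(1))
  also have "map (\<lambda>j. ?enc (period ({} # ss) (Symbol j))) [0..<Suc (length ss)] =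
      map (\<lambda>j. ?enc ((\<Prod>k<e. if contains x j k then code_a e k else code_b e k) * 2)) [0..<Suc (length ss)]"
    by (rule map_cong) (use period_Symbol in auto)
  finally show ?thesis
    unfolding x_def[symmetric] reduction_string_def attr num num_blockers_def by simp
qed

theorem theorem2:
  "\<exists>R :: nat \<times> nat set list \<Rightarrow> nat list.
     polytime_reduction bpc_instances bpc_yes enc_bpc ws_instances ws_yes enc_ws R \<and>
     (\<exists>g :: nat \<Rightarrow> nat. (\<lambda>d. real (g d)) \<in> O(\<lambda>d. real d) \<and>
        (\<forall>(d, ss) \<in> bpc_instances. d \<ge> 2 \<longrightarrow> (\<forall>p \<in> set (R (d, ss)). p \<le> d ^ g d)))"
proof (intro exI conjI)
  have "set (enc_bpc x) \<subseteq> {1..<nsym}" for x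
    by (cases x) (auto simp: enc_bpc_def enc_bit_def nsym_def)
  then have "polytime_computable bpc_instances enc_bpc enc_ws reduction"
    by (intro pt_polytime_computable[OF pt_reduction_string]) (auto simp: reduction_string_eq)
  then show "polytime_reduction bpc_instances bpc_yes enc_bpc ws_instances ws_yes enc_ws reduction"
    using reduction_instance reduction_correct by (auto simp: polytime_reduction_def)
  show "(\<lambda>d. real (48 * d + 25)) \<in> O(\<lambda>d. real d)"
    \<comment> \<open>\<open>73 = 48 + 25\<close>, valid from \<open>d = 1\<close> on.\<close>
    by (rule bigoI[of _ 73]) (auto intro!: eventually_sequentiallyI[of 1])
  show "\<forall>(d, ss) \<in> bpc_instances. d \<ge> 2 \<longrightarrow> (\<forall>p \<in> set (reduction (d, ss)). p \<le> d ^ (48 * d + 25))"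
    using reduction_bound by blast
qed

end
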